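(* Let $\mathcal{G}=(V,E)$ be a finite tree, let $x\in V$ have degree $m\ge 2$, and let $x_1,\dots,x_m$ be the neighbors of $x$. For $1\le j\le m$ let $\mathcal{G}_j:=\mathcal{H}_j(x_j,x)$, where $\mathcal{H}_j$ is the branch from $(x_j,x)$ in $\mathcal{G}$. Assume $\sigma(\mathcal{G}_1,x)\le\sigma(\mathcal{G}_2,x)\le\cdots\le\sigma(\mathcal{G}_m,x)$. Then: If $\sigma(\mathcal{G}_1,x)=\sigma(\mathcal{G}_2,x)$, then $\lambda_2(\mathcal{G})=\sigma(\mathcal{G}_1,x)$, and moreover any Steklov eigenfunction on $\mathcal{G}$ associated with $\lambda_2(\mathcal{G})$ vanishes at $x$. If $\sigma(\mathcal{G}_1,x)<\sigma(\mathcal{G}_2,x)$, then $\sigma(\mathcal{G}_1,x)<\lambda_2(\mathcal{G})<\sigma(\mathcal{G}_2,x)$.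
   Context: For a finite tree $\mathcal{G}=(V,E)$, $E$ is the set of directed edges (each edge appears with both orientations), $d$ is the combinatorial distance, the boundary $\delta\mathcal{G}$ is the set of vertices of degree one, and $\Omega:=V\setminus\delta\mathcal{G}$ is the interior. For $f\in\mathbb{R}^V$, $\Delta f(x)=\sum_{y\sim x}(f(x)-f(y))$, and for $x\in\delta\mathcal{G}$ with its neighbor $y$, $\frac{\partial f}{\partial n}(x)=f(x)-f(y)$. A real $\lambda$ is a Steklov eigenvalue of $\mathcal{G}$ if there is a nonzero $f\in\mathbb{R}^V$ (a Steklov eigenfunction associated with $\lambda$) with $\Delta f=0$ on $\Omega$ and $\frac{\partial f}{\partial n}=\lambda f$ on $\delta\mathcal{G}$. Counted with multiplicity these are $0=\lambda_1<\lambda_2\le\dots\le\lambda_{|\delta\mathcal{G}|}$, and $\lambda_2(\mathcal{G})$ denotes the first nonzero one. For $(x,y)\in E$, the branch from $(x,y)$ is the connected component $\mathcal{H}$ containing $x$ after removing the edge between $x$ and $y$ from $\mathcal{G}$; $\mathcal{H}(x,y)$ is the subtree generated by the vertices of $\mathcal{H}$ together with $y$ (so $y$ is a boundary vertex of $\mathcal{H}(x,y)$). For a finite tree $\mathcal{G}$, $x\in V$ and $\lambda\ge0$, a $\lambda$-flow to $x$ is a nonzero $f\in\mathbb{R}^V$ with $\Delta f(w)=0$ for $w\in\Omega\setminus\{x\}$ and $\frac{\partial f}{\partial n}(w)=\lambda f(w)$ for $w\in\delta\mathcal{G}\setminus\{x\}$. For $x\in\delta\mathcal{G}$, $\Sigma(\mathcal{G},x)$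 is the set of $\lambda\ge0$ for which there is a $\lambda$-flow $f$ to $x$ with $f(x)=0$ and $f(y)-f(z)>0$ for every $(y,z)\in E$ with $d(x,y)>d(x,z)$; and $\sigma(\mathcal{G},x):=\inf\Sigma(\mathcal{G},x)$. *)

theory Defs
  imports Complex_Main "Graph_Theory.Digraph_Component" "Graph_Theory.Shortest_Path"
begin

text \<open>
  Graphs are the finite simple symmetric digraphs of the locale \<^locale>\<open>graph\<close>; the edge set \<open>E\<close>
  is \<^term>\<open>arcs_ends G\<close>, which contains both orientations of each edge, and \<open>x \<rightarrow>\<^bsub>G\<^esub> y\<close> is
  adjacency. A function on the vertex set is a function on the whole type of which only
  the values on \<^term>\<open>verts G\<close> matter.

  The library's \<open>tree\<close> is not usable here: in a symmetric digraph it counts \<open>a, b, a\<close> as a cycle.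
  In a simple graph the closed walks \<open>a, b, a\<close> are the only cycles of length less than 3.
\<close>

definition finite_tree :: "('a, 'b) pre_digraph \<Rightarrow> bool" where
  "finite_tree G \<longleftrightarrow> graph G \<and> connected G \<and> \<not> (\<exists>p. pre_digraph.cycle G p \<and> length p \<ge> 3)"

definition graph_dist :: "('a, 'b) pre_digraph \<Rightarrow> 'a \<Rightarrow> 'a \<Rightarrow> ereal" where
  "graph_dist G = wf_digraph.\<mu> G (\<lambda>_. 1)"

definition boundary_verts :: "('a, 'b) pre_digraph \<Rightarrow> 'a set" where
  "boundary_verts G = {v \<in> verts G. out_degree G v = 1}"

definition interior_verts :: "('a, 'b) pre_digraph \<Rightarrow> 'a set" where
  "interior_verts G = verts G - boundary_verts G"

definition laplacian :: "('a, 'b) pre_digraph \<Rightarrow> ('a \<Rightarrow> real) \<Rightarrow> 'a \<Rightarrow> real" where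
  "laplacian G f x = (\<Sum>y | x \<rightarrow>\<^bsub>G\<^esub> y. f x - f y)"

text \<open>Only meaningful at boundary vertices, which have exactly one neighbor.\<close>

definition normal_deriv :: "('a, 'b) pre_digraph \<Rightarrow> ('a \<Rightarrow> real) \<Rightarrow> 'a \<Rightarrow> real" where
  "normal_deriv G f x = f x - f (THE y. x \<rightarrow>\<^bsub>G\<^esub> y)"

definition steklov_eigenfunction ::
    "('a, 'b) pre_digraph \<Rightarrow> real \<Rightarrow> ('a \<Rightarrow> real) \<Rightarrow> bool" where
  "steklov_eigenfunction G lam f \<longleftrightarrow>
     (\<exists>v\<in>verts G. f v \<noteq> 0) \<and>
     (\<forall>w\<in>interior_verts G. laplacian G f w = 0) \<and>
     (\<forall>w\<in>boundary_verts G. normal_deriv G f w = lam * f w)"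

definition steklov_eigenvalue :: "('a, 'b) pre_digraph \<Rightarrow> real \<Rightarrow> bool" where
  "steklov_eigenvalue G lam \<longleftrightarrow> (\<exists>f. steklov_eigenfunction G lam f)"

definition lambda2 :: "('a, 'b) pre_digraph \<Rightarrow> real" where
  "lambda2 G = (LEAST lam. steklov_eigenvalue G lam \<and> lam \<noteq> 0)"

definition del_edge :: "('a, 'b) pre_digraph \<Rightarrow> 'a \<Rightarrow> 'a \<Rightarrow> ('a, 'b) pre_digraph" where
  "del_edge G x y =
     \<lparr> verts = verts G, arcs = {e \<in> arcs G. arc_to_ends G e \<notin> {(x, y), (y, x)}},
       tail = tail G, head = head G \<rparr>"

text \<open>In a symmetric digraph, strongly connected components are the connected components.\<close>

definition branch_verts :: "('a, 'b) pre_digraph \<Rightarrow> 'a \<Rightarrow> 'a \<Rightarrow> 'a set" where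
  "branch_verts G x y = pre_digraph.scc_of (del_edge G x y) x"

definition branch_tree :: "('a, 'b) pre_digraph \<Rightarrow> 'a \<Rightarrow> 'a \<Rightarrow> ('a, 'b) pre_digraph" where
  "branch_tree G x y = G \<restriction> insert y (branch_verts G x y)"

definition lambda_flow ::
    "('a, 'b) pre_digraph \<Rightarrow> 'a \<Rightarrow> real \<Rightarrow> ('a \<Rightarrow> real) \<Rightarrow> bool" where
  "lambda_flow G x lam f \<longleftrightarrow>
     (\<exists>v\<in>verts G. f v \<noteq> 0) \<and>
     (\<forall>w\<in>interior_verts G - {x}. laplacian G f w = 0) \<and>
     (\<forall>w\<in>boundary_verts G - {x}. normal_deriv G f w = lam * f w)"

definition Sigma_flow :: "('a, 'b) pre_digraph \<Rightarrow> 'a \<Rightarrow> real set" where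
  "Sigma_flow G x =
     {lam. lam \<ge> 0 \<and>
       (\<exists>f. lambda_flow G x lam f \<and> f x = 0 \<and>
         (\<forall>y z. y \<rightarrow>\<^bsub>G\<^esub> z \<and> graph_dist G x y > graph_dist G x z \<longrightarrow> f y - f z > 0))}"

text \<open>
  For a boundary vertex of a finite tree the set is nonempty (a positive first eigenfunction with
  Dirichlet condition at \<open>x\<close>) and bounded below by 0, so the real infimum is the intended one.
\<close>

definition sigma_flow :: "('a, 'b) pre_digraph \<Rightarrow> 'a \<Rightarrow> real" where
  "sigma_flow G x = Inf (Sigma_flow G x)"

end

theory Submission
  imports Defs "HOL-Analysis.Function_Topology"
begin

text \<open>
  The Laplacian equals the normal derivative at a boundary vertex, so Steklov eigenfunctions solve
  \<open>E(f, g) = \<lambda> B(f, g)\<close> for all test functions \<open>g\<close>, where \<open>E\<close> is the Dirichlet energy and \<open>B\<close> the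
  inner product on the boundary. On the branch at \<open>x\<^sub>j\<close> the same problem with value \<open>0\<close> at \<open>x\<close> has a
  positive ground state \<open>\<phi>\<^sub>j\<close>; it is a flow, and no other eigenvalue has a positive eigenfunction, so
  \<open>\<sigma>(G\<^sub>j, x)\<close> is the minimum of \<open>E / B\<close> over functions supported on the branch.

  If \<open>f\<close> is a Steklov eigenfunction for \<open>\<lambda> < \<sigma>\<^sub>1\<close> with \<open>f x \<ge> 0\<close>, the maximum principle makes \<open>f\<close>
  nonnegative on every branch, while its boundary mean vanishes if \<open>\<lambda> \<noteq> 0\<close>; hence \<open>\<lambda>\<^sub>2 \<ge> \<sigma>\<^sub>1\<close>. For
  \<open>\<lambda> = \<sigma>\<^sub>1\<close>, pairing \<open>f\<close> with \<open>\<phi>\<^sub>1\<close> on the first branch gives \<open>f x = 0\<close>. If \<open>\<sigma>\<^sub>1 = \<sigma>\<^sub>2\<close>, a combination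
  of \<open>\<phi>\<^sub>1\<close> and \<open>\<phi>\<^sub>2\<close> without net flux into \<open>x\<close> is an eigenfunction. If \<open>\<sigma>\<^sub>1 < \<sigma>\<^sub>2\<close>, a combination with
  zero boundary mean has Rayleigh quotient below \<open>\<sigma>\<^sub>2\<close>, and an eigenfunction for \<open>\<sigma>\<^sub>1\<close> would vanish at
  \<open>x\<close>, hence on all branches but the first, hence at \<open>x\<^sub>1\<close> and everywhere.
\<close>

section \<open>Energy and Laplacian\<close>

text \<open>\<open>N\<close> and \<open>P\<close> scale alike, so \<open>N / P\<close> is unchanged
  by nonzero scaling and may be maximized on the unit sphere of \<open>W\<close>. This sphere is
  compact because its functions vanish off the finite set \<open>V\<close>. The cross-multiplied
  conclusion also covers \<open>g = 0\<close>.\<close>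

lemma homogeneous_ratio_attains_max:
  fixes N P :: "('a \<Rightarrow> real) \<Rightarrow> real"
  assumes V: "finite V" and W: "closed W" "\<And>f v. f \<in> W \<Longrightarrow> v \<notin> V \<Longrightarrow> f v = 0"
    and cont: "continuous_on UNIV N" "continuous_on UNIV P"
    and hom: "\<And>c f. N (\<lambda>v. c * f v) = c\<^sup>2 * N f" "\<And>c f. P (\<lambda>v. c * f v) = c\<^sup>2 * P f"
    and scale: "\<And>c f. f \<in> W \<Longrightarrow> (\<lambda>v. c * f v) \<in> W"
    and pos: "\<And>f. f \<in> W \<Longrightarrow> f \<noteq> (\<lambda>_. 0) \<Longrightarrow> P f > 0"
    and f0: "f0 \<in> W" "f0 \<noteq> (\<lambda>_. 0)"
  obtains f where "f \<in> W" "f \<noteq> (\<lambda>_. 0)" "\<And>g. g \<in> W \<Longrightarrow> N g * P f \<le> N f * P g"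
proof -
  define s :: "('a \<Rightarrow> real) \<Rightarrow> real" where "s f = (\<Sum>v\<in>V. (f v)\<^sup>2)" for f
  have cs: "continuous_on UNIV s"
    unfolding s_def
    by (intro continuous_on_sum continuous_on_power continuous_on_product_coordinates)
  have s_pos: "s f > 0" if "f \<in> W" "f \<noteq> (\<lambda>_. 0)" for f
  proof -
    from that W obtain v where "v \<in> V" "f v \<noteq> 0" by fastforce
    then show ?thesis unfolding s_def using V by (intro sum_pos2) auto
  qed
  define nrm where "nrm f = (\<lambda>v. (1 / sqrt (s f)) * f v)" for f
  have nrm_s: "s (nrm f) = 1" if "s f > 0" for f
  proof -
    have "s (nrm f) = (1 / sqrt (s f))\<^sup>2 * s f"
      unfolding nrm_def s_def sum_distrib_left power_mult_distrib ..
    then show ?thesis using that by (simp add: power_divide)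
  qed
  define K where "K = W \<inter> (s -` {1})"
  \<comment> \<open>Tychonoff's theorem for a box whose factors outside \<open>V\<close> degenerate
    to \<open>{0}\<close>.\<close>
  have "compactin (product_topology (\<lambda>_. euclidean) UNIV)
      (PiE UNIV (\<lambda>v. if v \<in> V then {-1..1::real} else {0}))"
    by (subst compactin_PiE) auto
  then have cbox: "compact (PiE UNIV (\<lambda>v. if v \<in> V then {-1..1::real} else {0}))"
    by (simp add: euclidean_product_topology)
  have sub: "K \<subseteq> PiE UNIV (\<lambda>v. if v \<in> V then {-1..1::real} else {0})"
  proof
    fix f assume f: "f \<in> K"
    have "\<bar>f v\<bar> \<le> 1" if "v \<in> V" for v
    proof -
      have "(f v)\<^sup>2 \<le> s f" unfolding s_def using that V by (intro member_le_sum) auto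
      also have "s f = 1" using f by (simp add: K_def)
      finally show ?thesis by (simp add: abs_square_le_1)
    qed
    then show "f \<in> PiE UNIV (\<lambda>v. if v \<in> V then {-1..1::real} else {0})"
      using f W(2) by (auto simp: K_def PiE_UNIV_domain abs_le_iff)
  qed
  have "closed K" unfolding K_def
    using W(1) continuous_on_closed_vimage[OF closed_UNIV, of s] cs by (intro closed_Int) auto
  then have compK: "compact K"
    using compact_Int_closed[OF cbox] sub by (metis inf.absorb_iff2)
  have nrmK: "nrm f \<in> K" if "f \<in> W" "f \<noteq> (\<lambda>_. 0)" for f
  proof -
    have "nrm f \<in> W" unfolding nrm_def by (rule scale[OF that(1)])
    then show ?thesis using nrm_s[OF s_pos[OF that]] by (simp add: K_def)
  qed
  have neK: "nrm f0 \<in> K" by (rule nrmK[OF f0])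
  have Knz: "f \<in> W" "f \<noteq> (\<lambda>_. 0)" if "f \<in> K" for f using that by (auto simp: K_def s_def)
  have PK: "P f > 0" if "f \<in> K" for f by (rule pos[OF Knz[OF that]])
  have "\<forall>f\<in>K. P f \<noteq> 0"
  proof
    fix f assume "f \<in> K"
    from PK[OF this] show "P f \<noteq> 0" by simp
  qed
  then have "continuous_on K (\<lambda>f. N f / P f)"
    by (rule continuous_on_divide[OF continuous_on_subset[OF cont(1) subset_UNIV]
          continuous_on_subset[OF cont(2) subset_UNIV]])
  then obtain f where f: "f \<in> K" and max: "\<And>g. g \<in> K \<Longrightarrow> N g / P g \<le> N f / P f"
    using continuous_attains_sup[OF compK, of "\<lambda>f. N f / P f"] neK by auto
  show thesis
  proof
    fix g assume g: "g \<in> W"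
    have Pf: "P f > 0" by (rule PK[OF f])
    show "N g * P f \<le> N f * P g"
    proof (cases "g = (\<lambda>_. 0)")
      case True
      then show ?thesis using hom[of 0 g] by simp
    next
      case False
      have "nrm g \<in> K" by (rule nrmK[OF g False])
      moreover have "N (nrm g) / P (nrm g) = N g / P g"
        unfolding nrm_def hom using s_pos[OF g False] by simp
      ultimately have "N g / P g \<le> N f / P f" using max by metis
      then show ?thesis using Pf pos[OF g False] by (simp add: field_simps)
    qed
  qed (use f Knz in auto)
qed

section \<open>Dirichlet energy, boundary form and the local eigenvalue equation\<close>

text \<open>The double sum meets each undirected edge in both orientations, hence the division by
  2.\<close>

definition energy :: "('a, 'b) pre_digraph \<Rightarrow> ('a \<Rightarrow> real) \<Rightarrow> ('a \<Rightarrow> real) \<Rightarrow> real" where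
  "energy G f g = (\<Sum>u\<in>verts G. \<Sum>v | u \<rightarrow>\<^bsub>G\<^esub> v. (f u - f v) * (g u - g v)) / 2"

definition bdry_form :: "('a, 'b) pre_digraph \<Rightarrow> ('a \<Rightarrow> real) \<Rightarrow> ('a \<Rightarrow> real) \<Rightarrow> real" where
  "bdry_form G f g = (\<Sum>w\<in>boundary_verts G. f w * g w)"

text \<open>One equation expresses both harmonicity and the Steklov condition.
  \<open>S = verts G\<close> gives the Steklov problem, a branch gives the flow equations.\<close>

definition eigen_on :: "('a, 'b) pre_digraph \<Rightarrow> 'a set \<Rightarrow> real \<Rightarrow> ('a \<Rightarrow> real) \<Rightarrow> bool" where
  "eigen_on G S lam f \<longleftrightarrow>
     (\<forall>w\<in>S. laplacian G f w = (if w \<in> boundary_verts G then lam * f w else 0))"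

lemma energy_lincomb:
  "energy G (\<lambda>v. a * f v + b * g v) h = a * energy G f h + b * energy G g h"
  unfolding energy_def by (simp add: sum.distrib sum_distrib_left algebra_simps sum_subtractf add_divide_distrib diff_divide_distrib)

lemma bdry_form_lincomb:
  "bdry_form G (\<lambda>v. a * f v + b * g v) h = a * bdry_form G f h + b * bdry_form G g h"
  unfolding bdry_form_def by (simp add: sum.distrib sum_distrib_left algebra_simps)

lemma energy_commute: "energy G f g = energy G g f"
  unfolding energy_def by (simp add: mult.commute)

lemma bdry_form_commute: "bdry_form G f g = bdry_form G g f"
  unfolding bdry_form_def by (simp add: mult.commute)

lemma bdry_form_nonneg: "bdry_form G f f \<ge> 0"
  unfolding bdry_form_def by (intro sum_nonneg) auto

lemma energy_nonneg: "energy G f f \<ge> 0"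
  unfolding energy_def by (auto intro!: sum_nonneg divide_nonneg_nonneg)

lemma energy_quadratic:
  "energy G (\<lambda>v. a * f v + b * g v) (\<lambda>v. a * f v + b * g v)
     = a\<^sup>2 * energy G f f + 2 * a * b * energy G f g + b\<^sup>2 * energy G g g"
proof -
  let ?h = "\<lambda>v. a * f v + b * g v"
  have "energy G ?h ?h = a * energy G ?h f + b * energy G ?h g"
    by (subst energy_lincomb) (simp only: energy_commute[of G _ ?h])
  also have "\<dots> = a * (a * energy G f f + b * energy G f g) + b * (a * energy G f g + b * energy G g g)"
    by (simp only: energy_lincomb energy_commute[of G g f])
  finally show ?thesis by (simp add: algebra_simps power2_eq_square)
qed

lemma bdry_form_quadratic:
  "bdry_form G (\<lambda>v. a * f v + b * g v) (\<lambda>v. a * f v + b * g v)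
     = a\<^sup>2 * bdry_form G f f + 2 * a * b * bdry_form G f g + b\<^sup>2 * bdry_form G g g"
proof -
  let ?h = "\<lambda>v. a * f v + b * g v"
  have "bdry_form G ?h ?h = a * bdry_form G ?h f + b * bdry_form G ?h g"
    by (subst bdry_form_lincomb) (simp only: bdry_form_commute[of G _ ?h])
  also have "\<dots> = a * (a * bdry_form G f f + b * bdry_form G f g) + b * (a * bdry_form G f g + b * bdry_form G g g)"
    by (simp only: bdry_form_lincomb bdry_form_commute[of G g f])
  finally show ?thesis by (simp add: algebra_simps power2_eq_square)
qed

lemma laplacian_lincomb:
  "laplacian G (\<lambda>v. a * f v + b * g v) w = a * laplacian G f w + b * laplacian G g w"
  unfolding laplacian_def by (simp add: sum.distrib[symmetric] sum_distrib_left algebra_simps)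

lemma eigen_onD:
  "eigen_on G S lam f \<Longrightarrow> w \<in> S \<Longrightarrow>
    laplacian G f w = (if w \<in> boundary_verts G then lam * f w else 0)"
  by (simp add: eigen_on_def)

lemma eigen_on_subset: "eigen_on G S lam f \<Longrightarrow> S' \<subseteq> S \<Longrightarrow> eigen_on G S' lam f"
  by (auto simp: eigen_on_def)

lemma eigen_on_lincomb:
  "eigen_on G S lam f \<Longrightarrow> eigen_on G S lam g \<Longrightarrow> eigen_on G S lam (\<lambda>v. a * f v + b * g v)"
  by (auto simp: eigen_on_def laplacian_lincomb algebra_simps)

text \<open>Reverse triangle inequality on each edge. It allows a minimizer to be replaced by its
  absolute value.\<close>

lemma energy_abs_le: "energy G (\<lambda>v. \<bar>f v\<bar>) (\<lambda>v. \<bar>f v\<bar>) \<le> energy G f f"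
proof -
  have "(\<bar>a\<bar> - \<bar>b\<bar>) * (\<bar>a\<bar> - \<bar>b\<bar>) \<le> (a - b) * (a - b)" for a b :: real
    using abs_triangle_ineq3[of a b] abs_le_square_iff[of "\<bar>a\<bar> - \<bar>b\<bar>" "a - b"]
    by (simp add: power2_eq_square)
  then show ?thesis unfolding energy_def by (intro divide_right_mono sum_mono) auto
qed

section \<open>Green's formula and the weak form of the equation\<close>

context graph
begin

lemma finite_boundary [simp]: "finite (boundary_verts G)"
  by (simp add: boundary_verts_def)

lemma boundary_subset: "boundary_verts G \<subseteq> verts G"
  by (auto simp: boundary_verts_def)

lemma adj_sym: "u \<rightarrow>\<^bsub>G\<^esub> v \<Longrightarrow> v \<rightarrow>\<^bsub>G\<^esub> u"
  using arcs_ends_symmetric[OF sym_arcs] .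

lemma finite_nbrs [simp]: "finite {v. u \<rightarrow>\<^bsub>G\<^esub> v}"
  by (rule finite_subset[OF _ finite_verts]) (auto dest: adj_in_verts)

lemma sum_nbrs_eq: "(\<Sum>v | u \<rightarrow>\<^bsub>G\<^esub> v. h v) = (\<Sum>v\<in>verts G. if u \<rightarrow>\<^bsub>G\<^esub> v then h v else (0::real))"
  by (subst sum.inter_filter[symmetric]) (auto intro!: sum.cong dest: adj_in_verts)

lemma sum_arcs_swap:
  "(\<Sum>u\<in>verts G. \<Sum>v | u \<rightarrow>\<^bsub>G\<^esub> v. h u v) = (\<Sum>u\<in>verts G. \<Sum>v | u \<rightarrow>\<^bsub>G\<^esub> v. h v u :: real)"
  unfolding sum_nbrs_eq by (subst sum.swap) (intro sum.cong refl if_cong; metis adj_sym)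

text \<open>Summation by parts: adding the sum to its image under reversal of edges yields twice the
  energy.\<close>

lemma green: "(\<Sum>u\<in>verts G. g u * laplacian G f u) = energy G f g"
proof -
  have eq: "(\<Sum>u\<in>verts G. g u * laplacian G f u) = (\<Sum>u\<in>verts G. \<Sum>v | u \<rightarrow>\<^bsub>G\<^esub> v. g u * (f u - f v))"
    by (simp add: laplacian_def sum_distrib_left)
  also have eq2: "\<dots> = (\<Sum>u\<in>verts G. \<Sum>v | u \<rightarrow>\<^bsub>G\<^esub> v. g v * (f v - f u))"
    by (rule sum_arcs_swap)
  have "2 * energy G f g = (\<Sum>u\<in>verts G. \<Sum>v | u \<rightarrow>\<^bsub>G\<^esub> v. g u * (f u - f v))
      + (\<Sum>u\<in>verts G. \<Sum>v | u \<rightarrow>\<^bsub>G\<^esub> v. g v * (f v - f u))"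
    by (simp add: energy_def sum.distrib[symmetric] algebra_simps)
  then show ?thesis using eq eq2 by simp
qed

lemma sum_laplacian: "(\<Sum>u\<in>verts G. laplacian G f u) = 0"
  using green[of "\<lambda>_. 1" f] by (simp add: energy_def)

lemma energy_cong:
  assumes "\<And>v. v \<in> verts G \<Longrightarrow> f v = f' v"
  shows "energy G f g = energy G f' g"
  unfolding energy_def using assms
  by (intro arg_cong[of _ _ "\<lambda>t. t / 2"] sum.cong refl) (auto dest: adj_in_verts)

lemma bdry_form_cong:
  assumes "\<And>v. v \<in> verts G \<Longrightarrow> f v = f' v"
  shows "bdry_form G f g = bdry_form G f' g"
  unfolding bdry_form_def using assms boundary_subset by (intro sum.cong refl) auto

text \<open>In Green's formula only vertices with \<open>g u \<noteq> 0\<close> contribute, and all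
  of these satisfy the equation.\<close>

lemma eigen_on_weak:
  assumes f: "eigen_on G S lam f" and S: "S \<subseteq> verts G"
    and g: "\<And>v. v \<in> verts G \<Longrightarrow> v \<notin> S \<Longrightarrow> g v = 0"
  shows "energy G f g = lam * bdry_form G f g"
proof -
  have "energy G f g = (\<Sum>u\<in>verts G. if u \<in> boundary_verts G then lam * (f u * g u) else 0)"
    unfolding green[symmetric]
  proof (rule sum.cong)
    fix u assume "u \<in> verts G"
    then show "g u * laplacian G f u = (if u \<in> boundary_verts G then lam * (f u * g u) else 0)"
      using f g by (cases "u \<in> S") (auto simp: eigen_on_def)
  qed simp
  also have "\<dots> = (\<Sum>u\<in>boundary_verts G. lam * (f u * g u))"
    using boundary_subset by (subst sum.inter_restrict[symmetric]) (auto simp: Int_absorb1)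
  finally show ?thesis by (simp add: bdry_form_def sum_distrib_left)
qed

text \<open>Testing against the indicator of a single vertex of \<open>S\<close> recovers the
  pointwise equation.\<close>

lemma eigen_on_iff_weak:
  assumes S: "S \<subseteq> verts G"
    and f: "\<And>g. (\<And>v. v \<notin> S \<Longrightarrow> g v = 0) \<Longrightarrow> energy G f g = lam * bdry_form G f g"
  shows "eigen_on G S lam f"
  unfolding eigen_on_def
proof
  fix w assume w: "w \<in> S"
  let ?g = "\<lambda>v. if v = w then 1 else (0::real)"
  have "laplacian G f w = (\<Sum>u\<in>verts G. ?g u * laplacian G f u)"
    using w S by (simp add: if_distrib[of "\<lambda>t. t * _"] sum.delta subset_iff cong: if_cong)
  also have "\<dots> = lam * bdry_form G f ?g" unfolding green using w by (intro f) auto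
  also have "bdry_form G f ?g = (if w \<in> boundary_verts G then f w else 0)"
    unfolding bdry_form_def by (simp add: if_distrib[of "\<lambda>t. _ * t"] sum.delta cong: if_cong)
  finally show "laplacian G f w = (if w \<in> boundary_verts G then lam * f w else 0)" by auto
qed

end

section \<open>Variational principle on a connected graph\<close>

locale connected_graph = graph +
  assumes conn: "connected G"
begin

text \<open>The form in which connectedness is used: induction along a walk that starts in
  \<open>T\<close>.\<close>

lemma vert_closed_eq_verts:
  assumes "T \<subseteq> verts G" "T \<noteq> {}" "\<And>u v. u \<in> T \<Longrightarrow> u \<rightarrow>\<^bsub>G\<^esub> v \<Longrightarrow> v \<in> T"
  shows "T = verts G"
proof -
  obtain t where t: "t \<in> T" using assms by auto
  have "v \<in> T" if "v \<in> verts G" for v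
  proof -
    have "t \<rightarrow>\<^sup>* v"
      using symmetric_connected_imp_strongly_connected[OF sym_arcs conn] t that assms(1)
      by (auto simp: strongly_connected_def)
    then show ?thesis by (induct rule: reachable_induct) (use t assms(3) in auto)
  qed
  then show ?thesis using assms(1) by auto
qed

lemma energy_zero_const:
  assumes "energy G f f = 0" "u \<in> verts G" "v \<in> verts G"
  shows "f u = f v"
proof -
  have "(\<Sum>u\<in>verts G. \<Sum>v | u \<rightarrow>\<^bsub>G\<^esub> v. (f u - f v) * (f u - f v)) = 0"
    using assms(1) by (simp add: energy_def)
  then have "\<forall>u\<in>verts G. (\<Sum>v | u \<rightarrow>\<^bsub>G\<^esub> v. (f u - f v) * (f u - f v)) = 0"
    by (subst (asm) sum_nonneg_eq_0_iff) (auto intro: sum_nonneg)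
  then have adj: "f a = f b" if "a \<rightarrow>\<^bsub>G\<^esub> b" for a b
    using that adj_in_verts[OF that] by (subst (asm) sum_nonneg_eq_0_iff) auto
  have "{a \<in> verts G. f a = f u} = verts G"
    by (rule vert_closed_eq_verts) (use assms adj adj_in_verts in auto)
  with assms(3) have "f v = f u" by blast
  then show ?thesis by simp
qed

text \<open>Zero energy makes \<open>f\<close> constant, and a zero boundary form makes that
  constant 0. Hence \<open>E + B\<close> is definite.\<close>

lemma energy_bdry_zero:
  assumes "boundary_verts G \<noteq> {}" "energy G f f + bdry_form G f f \<le> 0" "v \<in> verts G"
  shows "f v = 0"
proof -
  have E: "energy G f f = 0" and B: "bdry_form G f f = 0"
    using assms(2) energy_nonneg[of G f] bdry_form_nonneg[of G f] by auto
  obtain b where b: "b \<in> boundary_verts G" using assms(1) by auto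
  have "f b = 0" using B b by (auto simp: bdry_form_def sum_nonneg_eq_0_iff)
  then show ?thesis using energy_zero_const[OF E assms(3)] b boundary_subset by force
qed

text \<open>Maximizing \<open>B / (E + B)\<close> rather than minimizing \<open>E / B\<close> keeps the denominator definite.\<close>

lemma rayleigh_minimizer:
  assumes bd: "boundary_verts G \<noteq> {}"
    and W: "closed W" "\<And>f v. f \<in> W \<Longrightarrow> v \<notin> verts G \<Longrightarrow> f v = 0"
    and scale: "\<And>c f. f \<in> W \<Longrightarrow> (\<lambda>v. c * f v) \<in> W"
    and f0: "f0 \<in> W" "bdry_form G f0 f0 > 0"
  obtains f lam where "f \<in> W" "bdry_form G f f > 0" "energy G f f = lam * bdry_form G f f"
    "\<And>g. g \<in> W \<Longrightarrow> lam * bdry_form G g g \<le> energy G g g"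
proof -
  let ?N = "\<lambda>f. bdry_form G f f" and ?P = "\<lambda>f. energy G f f + bdry_form G f f"
  have cN: "continuous_on UNIV ?N"
    unfolding bdry_form_def
    by (intro continuous_on_sum continuous_on_mult continuous_on_product_coordinates)
  have cP: "continuous_on UNIV ?P"
    unfolding energy_def
    by (intro continuous_on_add cN continuous_on_divide continuous_on_sum continuous_on_mult
        continuous_on_diff continuous_on_product_coordinates continuous_on_const) auto
  have hN: "?N (\<lambda>v. c * f v) = c\<^sup>2 * ?N f" and hE: "energy G (\<lambda>v. c * f v) (\<lambda>v. c * f v) = c\<^sup>2 * energy G f f" for c f
    using bdry_form_quadratic[of G c f 0 f] energy_quadratic[of G c f 0 f] by simp_all
  obtain f where f: "f \<in> W" "f \<noteq> (\<lambda>_. 0)" and max: "\<And>g. g \<in> W \<Longrightarrow> ?N g * ?P f \<le> ?N f * ?P g"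
  proof (rule homogeneous_ratio_attains_max[of "verts G" W ?N ?P f0])
    fix f assume "f \<in> W" "f \<noteq> (\<lambda>_. 0)"
    then show "?P f > 0" using energy_bdry_zero[OF bd, of f] W(2) by (metis ext linorder_not_less)
  qed (use W scale f0 cN cP hN hE in \<open>auto simp: bdry_form_def algebra_simps\<close>)
  have Pf: "?P f > 0" using f energy_bdry_zero[OF bd, of f] W(2) by (metis ext linorder_not_less)
  \<comment> \<open>The competitor \<open>f0\<close> has a positive ratio, so the maximal ratio
    cannot be 0.\<close>
  have Nf: "?N f > 0"
  proof (rule ccontr)
    assume "\<not> ?N f > 0"
    then have "?N f0 * ?P f \<le> 0" using max[OF f0(1)] bdry_form_nonneg[of G f] by simp
    then show False using mult_pos_pos[OF f0(2) Pf] by linarith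
  qed
  show thesis
  proof (rule that[OF f(1) Nf, of "energy G f f / bdry_form G f f"])
    \<comment> \<open>The product of the two boundary forms cancels from both sides of the
      maximality inequality, which turns it into minimality of \<open>E / B\<close>.\<close>
    show "energy G f f / ?N f * ?N g \<le> energy G g g" if "g \<in> W" for g
      using max[OF that] Nf by (simp add: field_simps)
  qed (use Nf in auto)
qed

text \<open>\<open>E - lam * B\<close> is nonnegative on \<open>W\<close> and at most 0 at
  \<open>f\<close>. Along \<open>f + t * g\<close> this bounds below by 0 a quadratic in
  \<open>t\<close> without constant term, so its linear coefficient vanishes.\<close>

lemma rayleigh_euler_lagrange:
  assumes W: "\<And>f g t. f \<in> W \<Longrightarrow> g \<in> W \<Longrightarrow> (\<lambda>v. f v + t * g v) \<in> W"
    and f: "f \<in> W" "energy G f f \<le> lam * bdry_form G f f"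
    and min: "\<And>g. g \<in> W \<Longrightarrow> lam * bdry_form G g g \<le> energy G g g"
    and g: "g \<in> W"
  shows "energy G f g = lam * bdry_form G f g"
proof -
  define a where "a = energy G g g - lam * bdry_form G g g"
  define b where "b = energy G f g - lam * bdry_form G f g"
  have q: "0 \<le> 2 * t * b + t\<^sup>2 * a" for t
    using min[OF W[OF f(1) g, of t]] f(2) energy_quadratic[of G 1 f t g] bdry_form_quadratic[of G 1 f t g]
    unfolding a_def b_def by (simp add: algebra_simps)
  have "a \<ge> 0" using min[OF g] by (simp add: a_def)
  have "b = 0"
  proof (rule ccontr)
    assume "b \<noteq> 0"
    \<comment> \<open>The denominator \<open>a + 1\<close> keeps this choice of \<open>t\<close>
      meaningful when \<open>a = 0\<close>.\<close>
    have "2 * (- b / (a + 1)) * b + (- b / (a + 1))\<^sup>2 * a = - (b\<^sup>2 * (a + 2)) / (a + 1)\<^sup>2"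
      using \<open>a \<ge> 0\<close> by (simp add: divide_simps power2_eq_square) (simp add: algebra_simps)
    moreover have "\<dots> < 0" using \<open>a \<ge> 0\<close> \<open>b \<noteq> 0\<close> by (auto intro!: divide_neg_pos mult_pos_pos)
    ultimately show False using q[of "- b / (a + 1)"] by linarith
  qed
  then show ?thesis by (simp add: b_def)
qed

end

section \<open>Dirichlet ground states\<close>

text \<open>Connectedness of the subgraph induced on \<open>S\<close>, stated through closed subsets
  so that it applies directly to the zero set of a function.\<close>

definition linked :: "('a, 'b) pre_digraph \<Rightarrow> 'a set \<Rightarrow> bool" where
  "linked G S \<longleftrightarrow>
     (\<forall>T\<subseteq>S. T \<noteq> {} \<longrightarrow> (\<forall>u\<in>T. \<forall>v\<in>S. u \<rightarrow>\<^bsub>G\<^esub> v \<longrightarrow> v \<in> T) \<longrightarrow> T = S)"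

text \<open>This is how a branch sits in a tree: \<open>y\<close> is its root and \<open>z\<close>
  the vertex from which it hangs.\<close>

definition cut_off :: "('a, 'b) pre_digraph \<Rightarrow> 'a set \<Rightarrow> 'a \<Rightarrow> 'a \<Rightarrow> bool" where
  "cut_off G S y z \<longleftrightarrow> S \<subseteq> verts G \<and> y \<in> S \<and> z \<notin> S \<and> y \<rightarrow>\<^bsub>G\<^esub> z \<and>
     (\<forall>u v. u \<in> S \<longrightarrow> u \<rightarrow>\<^bsub>G\<^esub> v \<longrightarrow> v \<notin> S \<longrightarrow> u = y \<and> v = z)"

lemma linkedD:
  assumes "linked G S" "T \<subseteq> S" "T \<noteq> {}"
    and "\<And>u v. u \<in> T \<Longrightarrow> v \<in> S \<Longrightarrow> u \<rightarrow>\<^bsub>G\<^esub> v \<Longrightarrow> v \<in> T"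
  shows "T = S"
  using assms unfolding linked_def by blast

text \<open>The one edge leaving \<open>T\<close> does not have both ends in \<open>S\<close>, so
  \<open>S \<inter> T\<close> is closed under adjacency within \<open>S\<close>.\<close>

lemma linked_subset_cut_off:
  assumes "linked G S" "cut_off G T y z" "y \<notin> S \<or> z \<notin> S" "S \<inter> T \<noteq> {}"
  shows "S \<subseteq> T"
proof -
  have "S \<inter> T = S"
    using assms(2-4) by (intro linkedD[OF assms(1)]) (auto simp: cut_off_def)
  then show ?thesis by blast
qed

section \<open>Green's formula across a cut and positivity of eigenfunctions\<close>

context graph
begin

lemma cut_off_compl:
  assumes "cut_off G S y z"
  shows "cut_off G (verts G - S) z y"
  unfolding cut_off_def
proof (intro conjI allI impI)
  fix u v assume "u \<in> verts G - S" "u \<rightarrow>\<^bsub>G\<^esub> v" "v \<notin> verts G - S"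
  then have "v \<in> S" "v \<rightarrow>\<^bsub>G\<^esub> u" "u \<notin> S" using adj_sym adj_in_verts by auto
  then show "u = z" "v = y" using assms unfolding cut_off_def by blast+
qed (use assms adj_sym adj_in_verts in \<open>auto simp: cut_off_def\<close>)

text \<open>Outside \<open>S\<close> only \<open>z\<close> has a neighbor in \<open>S\<close>, and
  that neighbor is \<open>y\<close>.\<close>

lemma laplacian_off_cut:
  assumes S: "cut_off G S y z" and f: "\<And>v. v \<in> verts G \<Longrightarrow> v \<notin> S \<Longrightarrow> f v = 0"
    and u: "u \<in> verts G" "u \<notin> S"
  shows "laplacian G f u = (if u = z then - f y else 0)"
proof -
  have "laplacian G f u = (\<Sum>v | u \<rightarrow>\<^bsub>G\<^esub> v. if v = y then if u = z then - f y else 0 else 0)"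
    unfolding laplacian_def
  proof (rule sum.cong)
    fix v assume "v \<in> {v. u \<rightarrow>\<^bsub>G\<^esub> v}"
    then have "v \<in> verts G" "v \<rightarrow>\<^bsub>G\<^esub> u" "u \<rightarrow>\<^bsub>G\<^esub> v" using adj_in_verts adj_sym by auto
    then show "f u - f v = (if v = y then if u = z then - f y else 0 else 0)"
      using S f u unfolding cut_off_def by (cases "v \<in> S") auto
  qed simp
  also have "\<dots> = (if u = z then - f y else 0)"
    using S adj_sym unfolding cut_off_def by (auto simp: sum.delta)
  finally show ?thesis .
qed

text \<open>Discrete divergence theorem: Green's formula against the indicator of \<open>S\<close>,
  whose Laplacian is 1 at \<open>y\<close>, -1 at \<open>z\<close> and 0 elsewhere.\<close>

lemma sum_laplacian_cut:
  assumes S: "cut_off G S y z"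
  shows "(\<Sum>w\<in>S. laplacian G f w) = f y - f z"
proof -
  define g where "g v = (if v \<in> S then 1 else (0::real))" for v
  have SV: "S \<subseteq> verts G" "y \<in> S" "z \<in> verts G" "z \<notin> S"
    using S adj_in_verts by (auto simp: cut_off_def)
  have lap: "laplacian G g u = (if u = y then 1 else 0) - (if u = z then 1 else 0)"
    if u: "u \<in> verts G" for u
  proof (cases "u \<in> S")
    case True
    \<comment> \<open>On the vertices, \<open>1 - g\<close> is supported in the complement of
      \<open>S\<close>, which is cut off with \<open>y\<close> and \<open>z\<close>
      interchanged.\<close>
    have "laplacian G (\<lambda>v. 1 - g v) u = (if u = y then - (1 - g z) else 0)"
      by (rule laplacian_off_cut[OF cut_off_compl[OF S]]) (use True u in \<open>auto simp: g_def\<close>)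
    moreover have "laplacian G (\<lambda>v. 1 - g v) u = - laplacian G g u"
      by (simp add: laplacian_def sum_negf[symmetric])
    ultimately show ?thesis using SV True by (auto simp: g_def split: if_splits)
  next
    case False
    then show ?thesis
      using laplacian_off_cut[OF S, of g u] u SV by (auto simp: g_def)
  qed
  have "(\<Sum>w\<in>S. laplacian G f w) = (\<Sum>w\<in>verts G. g w * laplacian G f w)"
    using SV(1) by (simp add: g_def if_distrib[of "\<lambda>t. t * _"] sum.If_cases Int_absorb1 cong: if_cong)
  also have "\<dots> = (\<Sum>w\<in>verts G. f w * laplacian G g w)"
    unfolding green by (rule energy_commute)
  also have "\<dots> = (\<Sum>w\<in>verts G. (if w = y then f w else 0) - (if w = z then f w else 0))"
    by (rule sum.cong) (auto simp: lap)
  also have "\<dots> = f y - f z"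
    using SV by (simp add: sum_subtractf sum.delta' subset_iff)
  finally show ?thesis .
qed

text \<open>The energy of \<open>f\<close> and \<open>phi\<close> is computed from both equations.
  Extended by zero, \<open>phi\<close> violates its own only at \<open>z\<close>, where its
  Laplacian is \<open>- phi y\<close>. For \<open>lam = sig\<close> and \<open>phi y > 0\<close>
  this forces \<open>f z = 0\<close>.\<close>

lemma green_cut:
  assumes S: "cut_off G S y z"
    and phi: "eigen_on G S sig phi" "\<And>v. v \<notin> S \<Longrightarrow> phi v = 0"
    and f: "eigen_on G S lam f"
  shows "(sig - lam) * bdry_form G f phi = f z * phi y"
proof -
  have SV: "S \<subseteq> verts G" "z \<in> verts G" "z \<notin> S"
    using S adj_in_verts by (auto simp: cut_off_def)
  have "lam * bdry_form G f phi = energy G f phi"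
    by (rule eigen_on_weak[symmetric]) (use f SV phi in auto)
  also have "\<dots> = (\<Sum>w\<in>verts G. f w * laplacian G phi w)"
    unfolding green by (rule energy_commute)
  also have "\<dots> = (\<Sum>w\<in>verts G. (if w \<in> boundary_verts G then sig * (f w * phi w) else 0)
      - (if w = z then f z * phi y else 0))"
  proof (rule sum.cong)
    fix w assume "w \<in> verts G"
    then show "f w * laplacian G phi w = (if w \<in> boundary_verts G then sig * (f w * phi w) else 0)
      - (if w = z then f z * phi y else 0)"
      using phi laplacian_off_cut[OF S, of phi w] SV(3)
      by (cases "w \<in> S") (auto simp: eigen_on_def)
  qed simp
  also have "\<dots> = sig * bdry_form G f phi - f z * phi y"
    using SV boundary_subset
    by (simp add: sum_subtractf sum.If_cases bdry_form_def sum_distrib_left Int_absorb1)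
  finally show ?thesis by (simp add: algebra_simps)
qed

text \<open>The only neighbor outside \<open>S\<close> is \<open>x\<close>, where \<open>f\<close>
  already vanishes, so truncation leaves the Laplacian on \<open>S\<close> unchanged.\<close>

lemma eigen_on_restrict:
  assumes cut: "cut_off G S y x" and f: "eigen_on G S lam f" "f x = 0"
  shows "eigen_on G S lam (\<lambda>v. if v \<in> S then f v else 0)"
  unfolding eigen_on_def
proof
  fix w assume w: "w \<in> S"
  let ?g = "\<lambda>v. if v \<in> S then f v else 0"
  have "laplacian G ?g w = laplacian G f w"
    unfolding laplacian_def by (rule sum.cong) (use w cut f(2) in \<open>auto simp: cut_off_def\<close>)
  then show "laplacian G ?g w = (if w \<in> boundary_verts G then lam * ?g w else 0)"
    using eigen_onD[OF f(1) w] w by simp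
qed

text \<open>Strong minimum principle: at a zero the Laplacian vanishes even on the boundary, so the
  nonnegative neighboring values sum to 0. Zeros therefore spread through the linked set.\<close>

lemma eigen_on_zero_propagates:
  assumes S: "linked G S" "S \<subseteq> verts G" and f: "eigen_on G S lam f" "\<And>v. v \<in> verts G \<Longrightarrow> f v \<ge> 0"
    and w: "w \<in> S" "f w = 0" and u: "u \<in> S"
  shows "f u = 0"
proof -
  have "{v \<in> S. f v = 0} = S"
  proof (rule linkedD[OF S(1)])
    fix a b assume a: "a \<in> {v \<in> S. f v = 0}" and b: "b \<in> S" "a \<rightarrow>\<^bsub>G\<^esub> b"
    then have "laplacian G f a = 0" using eigen_onD[OF f(1), of a] by simp
    then have "(\<Sum>v | a \<rightarrow>\<^bsub>G\<^esub> v. f v) = 0"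
      using a by (simp add: laplacian_def sum_negf)
    then have "f b = 0"
      using b f(2) by (subst (asm) sum_nonneg_eq_0_iff) (auto dest: adj_in_verts)
    then show "b \<in> {v \<in> S. f v = 0}" using b by simp
  qed (use w in auto)
  then show ?thesis using u by blast
qed

text \<open>By symmetry of the energy, \<open>lam\<close> and \<open>sig\<close> agree after
  multiplication by the boundary form of \<open>f\<close> and \<open>g\<close>, which is positive
  because \<open>S\<close> meets the boundary.\<close>

lemma positive_eigen_unique:
  assumes S: "S \<subseteq> verts G" "S \<inter> boundary_verts G \<noteq> {}"
    and f: "eigen_on G S lam f" "\<And>v. v \<in> S \<Longrightarrow> f v > 0" "\<And>v. v \<notin> S \<Longrightarrow> f v = 0"
    and g: "eigen_on G S sig g" "\<And>v. v \<in> S \<Longrightarrow> g v > 0" "\<And>v. v \<notin> S \<Longrightarrow> g v = 0"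
  shows "lam = sig"
proof -
  have "energy G f g = lam * bdry_form G f g"
    by (rule eigen_on_weak[OF f(1) S(1) g(3)])
  moreover have "energy G g f = sig * bdry_form G g f"
    by (rule eigen_on_weak[OF g(1) S(1) f(3)])
  moreover have "bdry_form G f g > 0"
  proof -
    obtain b where b: "b \<in> S" "b \<in> boundary_verts G" using S(2) by auto
    have "f v * g v \<ge> 0" for v using f(2,3)[of v] g(2,3)[of v] by (cases "v \<in> S") auto
    then show ?thesis unfolding bdry_form_def
      using b f(2) g(2) by (intro sum_pos2[of _ b]) auto
  qed
  ultimately show ?thesis by (simp add: bdry_form_commute[of G g f] energy_commute[of G g f])
qed

text \<open>Let \<open>c * phi\<close> be the least multiple dominating \<open>g\<close>. The
  difference is a nonnegative eigenfunction with a zero in \<open>S\<close>, so it vanishes; then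
  \<open>g y = 0\<close> gives \<open>c = 0\<close>.\<close>

lemma positive_eigen_simple:
  assumes S: "linked G S" "S \<subseteq> verts G" "y \<in> S"
    and phi: "eigen_on G S lam phi" "\<And>v. v \<in> S \<Longrightarrow> phi v > 0" "\<And>v. v \<notin> S \<Longrightarrow> phi v = 0"
    and g: "eigen_on G S lam g" "\<And>v. v \<notin> S \<Longrightarrow> g v = 0" "g y = 0" and w: "w \<in> S"
  shows "g w = 0"
proof -
  have fin: "finite S" using S(2) by (rule finite_subset) simp
  define c where "c = Max ((\<lambda>v. g v / phi v) ` S)"
  have "c \<in> (\<lambda>v. g v / phi v) ` S" unfolding c_def using fin S(3) by (intro Max_in) auto
  then obtain u where u: "u \<in> S" "c = g u / phi u" by auto
  have le: "g v / phi v \<le> c" if "v \<in> S" for v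
    unfolding c_def using fin that by (intro Max_ge) auto
  let ?h = "\<lambda>v. c * phi v + (- 1) * g v"
  have "?h v \<ge> 0" for v
    using le[of v] phi(2)[of v] phi(3)[of v] g(2)[of v] by (cases "v \<in> S") (auto simp: field_simps)
  moreover have "?h u = 0" using u phi(2)[of u] by simp
  ultimately have h: "?h v = 0" if "v \<in> S" for v
    using that eigen_on_zero_propagates[OF S(1,2) eigen_on_lincomb[OF phi(1) g(1)] _ u(1)] by blast
  have "c = 0" using h[OF S(3)] g(3) phi(2)[OF S(3)] by simp
  then show ?thesis using h[OF w] by simp
qed

end

section \<open>Existence of the ground state and comparison below its value\<close>

context connected_graph
begin

text \<open>The absolute value of a minimizer of \<open>E / B\<close> is again a minimizer, and
  propagation of zeros makes it strictly positive on \<open>S\<close>. The value is positive, since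
  zero energy would make \<open>phi\<close> constant although it vanishes at
  \<open>x\<close>.\<close>

lemma dirichlet_ground_state:
  assumes S: "linked G S" "S \<subseteq> verts G" "S \<inter> boundary_verts G \<noteq> {}" and x: "x \<in> verts G" "x \<notin> S"
  obtains sig phi where "sig > 0" "eigen_on G S sig phi"
    "\<And>v. v \<in> S \<Longrightarrow> phi v > 0" "\<And>v. v \<notin> S \<Longrightarrow> phi v = 0"
    "\<And>g. (\<And>v. v \<notin> S \<Longrightarrow> g v = 0) \<Longrightarrow> sig * bdry_form G g g \<le> energy G g g"
proof -
  define W where "W = {f :: 'a \<Rightarrow> real. \<forall>v. v \<notin> S \<longrightarrow> f v = 0}"
  have "W = (\<Inter>v\<in>-S. (\<lambda>f. f v) -` {0})" by (auto simp: W_def)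
  then have clW: "closed W"
    by (auto intro!: closed_INT closed_vimage continuous_on_product_coordinates)
  obtain b where b: "b \<in> S" "b \<in> boundary_verts G" using S(3) by auto
  then have bd: "boundary_verts G \<noteq> {}" by auto
  obtain f lam where f: "f \<in> W" "bdry_form G f f > 0" "energy G f f = lam * bdry_form G f f"
    and min: "\<And>g. g \<in> W \<Longrightarrow> lam * bdry_form G g g \<le> energy G g g"
  proof (rule rayleigh_minimizer[OF bd clW])
    show "bdry_form G (\<lambda>v. if v = b then 1 else 0) (\<lambda>v. if v = b then 1 else 0) > 0"
      unfolding bdry_form_def by (rule sum_pos2[of _ b]) (use b in auto)
  qed (use b S(2) in \<open>auto simp: W_def\<close>)
  define phi where "phi v = \<bar>f v\<bar>" for v
  have phiW: "phi \<in> W" using f(1) by (auto simp: W_def phi_def)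
  have B: "bdry_form G phi phi = bdry_form G f f" by (simp add: bdry_form_def phi_def)
  have E: "energy G phi phi \<le> lam * bdry_form G phi phi"
    using energy_abs_le[of G f] f(3) B by (simp add: phi_def[abs_def])
  have eig: "eigen_on G S lam phi"
  proof (rule eigen_on_iff_weak[OF S(2)])
    fix g :: "'a \<Rightarrow> real" assume "\<And>v. v \<notin> S \<Longrightarrow> g v = 0"
    then show "energy G phi g = lam * bdry_form G phi g"
      by (intro rayleigh_euler_lagrange[OF _ phiW E min]) (auto simp: W_def)
  qed
  have off: "phi v = 0" if "v \<notin> S" for v using phiW that by (auto simp: W_def)
  have pos: "phi v > 0" if "v \<in> S" for v
  proof (rule ccontr)
    assume "\<not> phi v > 0"
    then have "phi v = 0" by (simp add: phi_def)
    then have "phi u = 0" if "u \<in> S" for u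
      using eigen_on_zero_propagates[OF S(1,2) eig _ \<open>v \<in> S\<close>] that by (auto simp: phi_def)
    then have "phi u = 0" for u using off by blast
    then show False using B f(2) by (simp add: bdry_form_def)
  qed
  have "lam > 0"
  proof (rule ccontr)
    assume "\<not> lam > 0"
    then have "energy G phi phi = 0"
      using E B f(2) energy_nonneg[of G phi] mult_nonpos_nonneg[of lam "bdry_form G f f"] by auto
    then have "phi b = phi x" using b S(2) x by (intro energy_zero_const) auto
    then show False using pos[OF b(1)] off[OF x(2)] by simp
  qed
  then show thesis using that eig pos off min by (auto simp: W_def)
qed

text \<open>Test the equation against the negative part of \<open>f\<close> on \<open>S\<close>.\<close>

lemma eigen_on_nonneg:
  assumes bd: "boundary_verts G \<noteq> {}" and S: "S \<subseteq> verts G"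
    and f: "eigen_on G S lam f" "\<And>u v. u \<in> S \<Longrightarrow> u \<rightarrow>\<^bsub>G\<^esub> v \<Longrightarrow> v \<notin> S \<Longrightarrow> f v \<ge> 0"
    and lam: "lam < sig"
    and min: "\<And>g. (\<And>v. v \<notin> S \<Longrightarrow> g v = 0) \<Longrightarrow> sig * bdry_form G g g \<le> energy G g g"
    and w: "w \<in> S"
  shows "f w \<ge> 0"
proof -
  define h where "h v = (if v \<in> S then max 0 (- f v) else 0)" for v
  have off: "h v = 0" if "v \<notin> S" for v using that by (simp add: h_def)
  have arc: "(f u - f v) * (h u - h v) \<le> - ((h u - h v) * (h u - h v))" if uv: "u \<rightarrow>\<^bsub>G\<^esub> v" for u v
  proof -
    \<comment> \<open>On \<open>S\<close>, \<open>f + h\<close> is the positive part of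
      \<open>f\<close> and \<open>h\<close> the negative part, so their increments never have the
      same strict sign. On an edge leaving \<open>S\<close> the outer value of \<open>f\<close> is
      nonnegative.\<close>
    have "((f u + h u) - (f v + h v)) * (h u - h v) \<le> 0"
    proof (cases "u \<in> S"; cases "v \<in> S")
      assume "u \<in> S" "v \<in> S"
      then show ?thesis
        by (cases "f u \<ge> 0"; cases "f v \<ge> 0") (auto simp: h_def mult_le_0_iff)
    next
      assume "u \<in> S" "v \<notin> S"
      then show ?thesis using f(2)[OF _ uv] by (cases "f u \<ge> 0") (auto simp: h_def mult_le_0_iff)
    next
      assume "u \<notin> S" "v \<in> S"
      then show ?thesis using f(2)[OF _ adj_sym[OF uv]]
        by (cases "f v \<ge> 0") (auto simp: h_def mult_le_0_iff)
    qed (auto simp: h_def)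
    then show ?thesis by (simp add: algebra_simps)
  qed
  have "energy G f h \<le> - energy G h h"
    unfolding energy_def minus_divide_left sum_negf[symmetric]
    by (intro divide_right_mono sum_mono arc) auto
  moreover have "energy G f h = lam * bdry_form G f h"
    by (rule eigen_on_weak[OF f(1) S off])
  moreover have "bdry_form G f h = - bdry_form G h h"
    unfolding bdry_form_def sum_negf[symmetric] by (rule sum.cong) (auto simp: h_def max_def)
  ultimately have E: "energy G h h \<le> lam * bdry_form G h h" by simp
  have "sig * bdry_form G h h \<le> energy G h h" by (rule min) (rule off)
  with E have "(sig - lam) * bdry_form G h h \<le> 0" by (simp add: algebra_simps)
  then have "bdry_form G h h = 0"
    using lam bdry_form_nonneg[of G h] by (auto simp: mult_le_0_iff)
  then have "h w = 0" using E energy_bdry_zero[OF bd, of h w] w S by auto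
  then show ?thesis using w by (simp add: h_def max_def split: if_splits)
qed

text \<open>Pairing \<open>f\<close> with itself gives \<open>E = lam * B\<close>, while
  \<open>E\<close> is at least \<open>sig * B\<close>; since \<open>lam < sig\<close>, both forms
  vanish at \<open>f\<close>.\<close>

lemma eigen_on_below_zero:
  assumes bd: "boundary_verts G \<noteq> {}" and S: "S \<subseteq> verts G"
    and f: "eigen_on G S lam f" "\<And>v. v \<notin> S \<Longrightarrow> f v = 0"
    and lam: "lam < sig"
    and min: "\<And>g. (\<And>v. v \<notin> S \<Longrightarrow> g v = 0) \<Longrightarrow> sig * bdry_form G g g \<le> energy G g g"
    and w: "w \<in> S"
  shows "f w = 0"
proof -
  have E: "energy G f f = lam * bdry_form G f f"
    by (rule eigen_on_weak[OF f(1) S f(2)])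
  moreover have "sig * bdry_form G f f \<le> energy G f f" by (rule min) (rule f(2))
  ultimately have "(sig - lam) * bdry_form G f f \<le> 0" by (simp add: algebra_simps)
  then have "bdry_form G f f = 0"
    using lam bdry_form_nonneg[of G f] by (auto simp: mult_le_0_iff)
  then show ?thesis using E energy_bdry_zero[OF bd, of f w] w S by auto
qed

end

section \<open>Branches of a tree\<close>

context graph
begin

lemma out_degree_eq_card_nbrs: "out_degree G u = card {v. u \<rightarrow>\<^bsub>G\<^esub> v}"
proof -
  have "bij_betw (head G) (out_arcs G u) {v. u \<rightarrow>\<^bsub>G\<^esub> v}"
    unfolding bij_betw_def
  proof
    show "inj_on (head G) (out_arcs G u)"
      by (rule inj_onI) (auto intro: no_multi_arcs simp: arc_to_ends_def)
    show "head G ` out_arcs G u = {v. u \<rightarrow>\<^bsub>G\<^esub> v}"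
      by (auto simp: arcs_ends_conv)
  qed
  then show ?thesis unfolding out_degree_def by (rule bij_betw_same_card)
qed

lemma boundary_iff: "w \<in> boundary_verts G \<longleftrightarrow> w \<in> verts G \<and> card {v. w \<rightarrow>\<^bsub>G\<^esub> v} = 1"
  by (simp add: boundary_verts_def out_degree_eq_card_nbrs)

lemma normal_deriv_eq_laplacian:
  assumes "w \<in> boundary_verts G"
  shows "normal_deriv G f w = laplacian G f w"
proof -
  obtain y where y: "{v. w \<rightarrow>\<^bsub>G\<^esub> v} = {y}"
    using assms by (auto simp: boundary_iff card_1_singleton_iff)
  then have "(THE v. w \<rightarrow>\<^bsub>G\<^esub> v) = y" by blast
  then show ?thesis unfolding normal_deriv_def laplacian_def y by simp
qed

lemma flow_equations_iff_eigen_on: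
  assumes "S \<subseteq> verts G"
  shows "(\<forall>w\<in>interior_verts G \<inter> S. laplacian G f w = 0) \<and>
      (\<forall>w\<in>boundary_verts G \<inter> S. normal_deriv G f w = lam * f w) \<longleftrightarrow> eigen_on G S lam f"
  using assms by (auto simp: eigen_on_def interior_verts_def normal_deriv_eq_laplacian)

lemma steklov_eigenfunction_iff:
  "steklov_eigenfunction G lam f \<longleftrightarrow> (\<exists>v\<in>verts G. f v \<noteq> 0) \<and> eigen_on G (verts G) lam f"
  using flow_equations_iff_eigen_on[of "verts G" f lam] boundary_subset
  by (auto simp: steklov_eigenfunction_def interior_verts_def Int_absorb2)

lemma del_edge_simps [simp]:
  "verts (del_edge G y z) = verts G" "tail (del_edge G y z) = tail G"
  "head (del_edge G y z) = head G"
  by (auto simp: del_edge_def)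

lemma del_edge_adj:
  "u \<rightarrow>\<^bsub>del_edge G y z\<^esub> v \<longleftrightarrow> u \<rightarrow>\<^bsub>G\<^esub> v \<and> (u, v) \<noteq> (y, z) \<and> (u, v) \<noteq> (z, y)"
  by (auto simp: arcs_ends_def del_edge_def arc_to_ends_def)

lemma del_edge_sym_digraph: "sym_digraph (del_edge G y z)"
proof -
  interpret D: wf_digraph "del_edge G y z"
    by unfold_locales (auto simp: del_edge_def)
  show ?thesis
    by (rule D.sym_digraphI) (auto simp: symmetric_def sym_def del_edge_adj dest: adj_sym)
qed

text \<open>Both orientations of the edge are deleted, so the digraph stays symmetric and
  reachability in one direction suffices.\<close>

lemma mem_branch_verts: "v \<in> branch_verts G y z \<longleftrightarrow> y \<rightarrow>\<^sup>*\<^bsub>del_edge G y z\<^esub> v"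
proof -
  interpret D: sym_digraph "del_edge G y z" by (rule del_edge_sym_digraph)
  show ?thesis
    unfolding branch_verts_def pre_digraph.scc_of_def using D.symmetric_reachable' by auto
qed

lemma self_mem_branch_verts: "y \<in> verts G \<Longrightarrow> y \<in> branch_verts G y z"
  by (simp add: mem_branch_verts reachable_def)

lemma branch_verts_closed:
  assumes "u \<in> branch_verts G y z" "u \<rightarrow>\<^bsub>G\<^esub> v" "(u, v) \<noteq> (y, z)" "(u, v) \<noteq> (z, y)"
  shows "v \<in> branch_verts G y z"
proof -
  interpret D: sym_digraph "del_edge G y z" by (rule del_edge_sym_digraph)
  show ?thesis using assms D.reachable_adj_trans unfolding mem_branch_verts
    by (auto simp: del_edge_adj)
qed

lemma branch_verts_subset: "branch_verts G y z \<subseteq> verts G"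
proof
  fix v assume "v \<in> branch_verts G y z"
  then have "y \<rightarrow>\<^sup>*\<^bsub>del_edge G y z\<^esub> v" by (simp add: mem_branch_verts)
  then show "v \<in> verts G" by (rule reachable_in_vertsE) simp
qed

lemma branch_verts_linked:
  assumes "z \<notin> branch_verts G y z"
  shows "linked G (branch_verts G y z)"
  unfolding linked_def
proof (intro allI impI)
  interpret D: sym_digraph "del_edge G y z" by (rule del_edge_sym_digraph)
  fix T assume T: "T \<subseteq> branch_verts G y z" "T \<noteq> {}"
    "\<forall>u\<in>T. \<forall>v\<in>branch_verts G y z. u \<rightarrow>\<^bsub>G\<^esub> v \<longrightarrow> v \<in> T"
  obtain t where t: "t \<in> T" using T(2) by auto
  have "v \<in> T" if v: "v \<in> branch_verts G y z" for v
  proof -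
    have "t \<rightarrow>\<^sup>*\<^bsub>del_edge G y z\<^esub> v"
    proof (rule D.reachable_trans[OF D.symmetric_reachable'])
      show "y \<rightarrow>\<^sup>*\<^bsub>del_edge G y z\<^esub> t" "y \<rightarrow>\<^sup>*\<^bsub>del_edge G y z\<^esub> v"
        using t T(1) v by (auto simp: mem_branch_verts[symmetric])
    qed
    then show ?thesis
    proof (induct rule: D.reachable_induct)
      case (step a b)
      then have "b \<in> branch_verts G y z"
        using T(1) D.reachable_adj_trans by (auto simp: mem_branch_verts)
      then show ?case using step T(3) by (auto simp: del_edge_adj)
    qed (rule t)
  qed
  then show "T = branch_verts G y z" using T(1) by auto
qed

lemma branch_verts_cut_off:
  assumes yz: "y \<rightarrow>\<^bsub>G\<^esub> z" and z: "z \<notin> branch_verts G y z"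
  shows "cut_off G (branch_verts G y z) y z"
  unfolding cut_off_def
proof (intro conjI allI impI)
  fix u v assume u: "u \<in> branch_verts G y z" "u \<rightarrow>\<^bsub>G\<^esub> v" "v \<notin> branch_verts G y z"
  then have "(u, v) = (y, z)" using branch_verts_closed[OF u(1,2)] z by auto
  then show "u = y" "v = z" by auto
qed (use assms branch_verts_subset self_mem_branch_verts adj_in_verts in auto)

end

section \<open>Trees: every edge separates\<close>

locale tree_graph = connected_graph +
  assumes no_cycle: "cycle p \<Longrightarrow> length p < 3"
begin

text \<open>A path from \<open>y\<close> to \<open>z\<close> that avoids the edge would close up
  with the arc from \<open>z\<close> to \<open>y\<close> to a cycle. Paths of length 0 and 1 are
  treated separately: \<open>y\<close> and \<open>z\<close> differ, and the edge between them is
  deleted.\<close>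

lemma head_notin_branch_verts:
  assumes yz: "y \<rightarrow>\<^bsub>G\<^esub> z"
  shows "z \<notin> branch_verts G y z"
proof
  interpret D: sym_digraph "del_edge G y z" by (rule del_edge_sym_digraph)
  assume "z \<in> branch_verts G y z"
  then obtain p where "D.apath y p z"
    by (auto simp: mem_branch_verts D.reachable_apath)
  then have p: "D.awalk y p z" "distinct (D.awalk_verts y p)" by (auto simp: D.apath_def)
  have "subgraph (del_edge G y z) G"
    using D.wf_digraph
    by (intro subgraphI) (auto simp: del_edge_def compatible_def wf_digraph)
  then have walk: "awalk y p z" using subgraph_awalk_imp_awalk p(1) by blast
  have "D.awalk_verts u q = awalk_verts u q" for u q
    by (induct q arbitrary: u) (auto simp: D.awalk_verts.simps)
  then have dist: "distinct (awalk_verts y p)" using p(2) by simp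
  obtain e where e: "e \<in> arcs G" "tail G e = z" "head G e = y"
    using adj_sym[OF yz] by (rule reachableE)
  have "cycle (e # p)"
    unfolding cycle_def using walk dist e by (intro exI[of _ z]) (auto simp: awalk_Cons_iff)
  then have "length p < 2" using no_cycle by fastforce
  then consider "p = []" | a where "p = [a]" by (cases p) (auto simp: less_Suc_eq)
  then show False
  proof cases
    case 1
    then show False using p(1) yz adj_not_same by (auto simp: D.awalk_Nil_iff)
  next
    case (2 a)
    then have "y \<rightarrow>\<^bsub>del_edge G y z\<^esub> z"
      using p(1) D.in_arcs_imp_in_arcs_ends[of a] by (auto simp: D.awalk_simps)
    then show False by (simp add: del_edge_adj)
  qed
qed

lemmas branch_cut_off = branch_verts_cut_off[OF _ head_notin_branch_verts]
lemmas branch_linked = branch_verts_linked[OF head_notin_branch_verts]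

text \<open>Induction on the size of the branch. If \<open>y\<close> is not a boundary vertex, it
  has a neighbor \<open>u\<close> other than \<open>z\<close>, and the branch from
  \<open>(u, y)\<close> is a smaller one inside, since it misses \<open>y\<close>.\<close>

lemma branch_meets_boundary:
  assumes "y \<rightarrow>\<^bsub>G\<^esub> z"
  shows "branch_verts G y z \<inter> boundary_verts G \<noteq> {}"
  using assms
proof (induct "card (branch_verts G y z)" arbitrary: y z rule: less_induct)
  case less
  note cut = branch_cut_off[OF less.prems less.prems]
  show ?case
  proof (cases "y \<in> boundary_verts G")
    case True
    then show ?thesis using cut by (auto simp: cut_off_def)
  next
    case False
    have "{v. y \<rightarrow>\<^bsub>G\<^esub> v} \<noteq> {z}"
      using False adj_in_verts[OF less.prems] by (auto simp: boundary_iff)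
    then obtain u where u: "y \<rightarrow>\<^bsub>G\<^esub> u" "u \<noteq> z" using less.prems by blast
    have uy: "u \<rightarrow>\<^bsub>G\<^esub> y" using u adj_sym by auto
    note cutu = branch_cut_off[OF uy uy]
    have "u \<in> branch_verts G y z" using cut u unfolding cut_off_def by blast
    then have "branch_verts G u y \<subseteq> branch_verts G y z"
      using cutu by (intro linked_subset_cut_off[OF branch_linked[OF uy] cut]) (auto simp: cut_off_def)
    then have sub: "branch_verts G u y \<subset> branch_verts G y z"
      using cut cutu by (auto simp: cut_off_def)
    then have "card (branch_verts G u y) < card (branch_verts G y z)"
      by (intro psubset_card_mono) (auto intro: finite_subset[OF branch_verts_subset])
    then have "branch_verts G u y \<inter> boundary_verts G \<noteq> {}" using less.hyps uy by blast
    then show ?thesis using sub by blast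
  qed
qed

end

section \<open>Flows on branches\<close>

context graph
begin

lemma dist_walk_le:
  assumes "awalk u p v"
  shows "graph_dist G u v \<le> length p"
proof -
  have "awalk_cost (\<lambda>_. 1) p = length p" by (induct p) auto
  then show ?thesis using min_cost_le_walk_cost[OF assms, of "\<lambda>_. 1"] by (simp add: graph_dist_def)
qed

lemma dist_realized:
  assumes "u \<rightarrow>\<^sup>*\<^bsub>G\<^esub> v"
  obtains p where "awalk u p v" "graph_dist G u v = length p"
proof -
  have cost: "awalk_cost (\<lambda>_. 1) p = length p" for p :: "'b list" by (induct p) auto
  obtain p where "apath u p v" "\<mu> (\<lambda>_. 1) u v = awalk_cost (\<lambda>_. 1) p"
    using min_cost_awalk[OF assms, of "\<lambda>_. 1"] by auto
  then show thesis using that[of p] by (simp add: graph_dist_def apath_def cost)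
qed

lemma exists_closer_neighbour:
  assumes "x \<rightarrow>\<^sup>*\<^bsub>G\<^esub> y" "x \<noteq> y"
  obtains z where "y \<rightarrow>\<^bsub>G\<^esub> z" "graph_dist G x z < graph_dist G x y"
proof -
  obtain p where p: "awalk x p y" "graph_dist G x y = length p"
    using assms(1) by (rule dist_realized)
  then obtain q e where q: "p = q @ [e]" using assms(2) by (cases p rule: rev_cases) (auto simp: awalk_Nil_iff)
  then have w: "awalk x q (tail G e)" "e \<in> arcs G" "head G e = y"
    using p(1) by (auto simp: awalk_simps)
  then have "tail G e \<rightarrow>\<^bsub>G\<^esub> y" using in_arcs_imp_in_arcs_ends by blast
  then have "y \<rightarrow>\<^bsub>G\<^esub> tail G e" by (rule adj_sym)
  moreover have "graph_dist G x (tail G e) < graph_dist G x y"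
    using dist_walk_le[OF w(1)] unfolding p(2) q by (auto elim: le_less_trans)
  ultimately show thesis by (rule that)
qed

text \<open>The walk is truncated just before its first exit from \<open>B\<close>, which happens at
  \<open>y\<close>.\<close>

lemma cut_off_walk:
  assumes cut: "\<And>a b. a \<in> B \<Longrightarrow> a \<rightarrow>\<^bsub>G\<^esub> b \<Longrightarrow> b \<notin> B \<Longrightarrow> a = y \<and> b = z"
    and p: "awalk u p v" "u \<in> B" "v \<notin> B"
  obtains q where "awalk u q y" "length q < length p"
proof -
  have "\<exists>q. awalk u q y \<and> length q < length p"
    using p
  proof (induct p arbitrary: u)
    case Nil
    then show ?case by (auto simp: awalk_Nil_iff)
  next
    case (Cons e p)
    then have e: "e \<in> arcs G" "tail G e = u" "awalk (head G e) p v" by (auto simp: awalk_Cons_iff)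
    then have adj: "u \<rightarrow>\<^bsub>G\<^esub> head G e" using in_arcs_imp_in_arcs_ends by blast
    show ?case
    proof (cases "head G e \<in> B")
      case True
      then obtain q where "awalk (head G e) q y" "length q < length p"
        using Cons.hyps e(3) Cons.prems(3) by blast
      then show ?thesis using e by (intro exI[of _ "e # q"]) (auto simp: awalk_Cons_iff)
    next
      case False
      then have "u = y" using cut Cons.prems(2) adj by blast
      then show ?thesis using adj adj_in_verts
        by (intro exI[of _ "[]"]) (auto simp: awalk_Nil_iff)
    qed
  qed
  then show thesis using that by blast
qed

end

section \<open>The value sigma of a branch as its ground state value\<close>

context tree_graph
begin

context
  fixes x y :: 'a
  assumes yx: "y \<rightarrow>\<^bsub>G\<^esub> x"
begin

private abbreviation (input) "S \<equiv> branch_verts G y x"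
private abbreviation (input) "T \<equiv> branch_tree G y x"

private lemma branch_cut: "cut_off G S y x"
  by (rule branch_cut_off[OF yx yx])

lemma branch_tree_verts: "verts T = insert x S"
  by (simp add: branch_tree_def)

lemma branch_tree_adj:
  "u \<rightarrow>\<^bsub>T\<^esub> v \<longleftrightarrow> u \<rightarrow>\<^bsub>G\<^esub> v \<and> u \<in> insert x S \<and> v \<in> insert x S"
  by (auto simp: branch_tree_def arcs_ends_conv)

lemma branch_tree_graph: "graph T"
proof -
  have sub: "insert x S \<subseteq> verts G" using branch_verts_subset adj_in_verts[OF yx] by blast
  then have ind: "induced_subgraph T G" unfolding branch_tree_def by (rule induced_induce)
  interpret T: digraph T by (rule digraphI_induced[OF ind])
  show ?thesis
    by (rule T.graphI) (rule induced_graph_imp_symmetric[OF sym_arcs ind])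
qed

interpretation T: graph T by (rule branch_tree_graph)

lemma branch_tree_nbrs: "w \<in> S \<Longrightarrow> {v. w \<rightarrow>\<^bsub>T\<^esub> v} = {v. w \<rightarrow>\<^bsub>G\<^esub> v}"
  using branch_cut by (auto simp: branch_tree_adj cut_off_def)

text \<open>Vertices of \<open>S\<close> keep all their neighbors in \<open>T\<close>, hence their
  degree and Laplacian, so flows on the branch tree can be studied inside \<open>G\<close>.\<close>

lemma branch_tree_eigen_on: "eigen_on T S lam f \<longleftrightarrow> eigen_on G S lam f"
proof -
  have "w \<in> boundary_verts T \<longleftrightarrow> w \<in> boundary_verts G" if "w \<in> S" for w
    unfolding T.boundary_iff boundary_iff branch_tree_nbrs[OF that]
    using that branch_verts_subset by (auto simp: branch_tree_verts)
  then show ?thesis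
    unfolding eigen_on_def laplacian_def by (simp add: branch_tree_nbrs)
qed

lemma branch_tree_flow:
  "lambda_flow T x lam f \<longleftrightarrow> (\<exists>v\<in>insert x S. f v \<noteq> 0) \<and> eigen_on G S lam f"
proof -
  have "x \<notin> S" using branch_cut by (auto simp: cut_off_def)
  then have "interior_verts T - {x} = interior_verts T \<inter> S"
      "boundary_verts T - {x} = boundary_verts T \<inter> S"
    using T.boundary_subset by (auto simp: interior_verts_def branch_tree_verts)
  then show ?thesis
    using T.flow_equations_iff_eigen_on[of S f lam]
    by (auto simp: lambda_flow_def branch_tree_verts branch_tree_eigen_on)
qed

lemma branch_tree_reachable: "v \<in> S \<Longrightarrow> x \<rightarrow>\<^sup>*\<^bsub>T\<^esub> v"
proof -
  assume v: "v \<in> S"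
  have "y \<in> S" using branch_cut by (auto simp: cut_off_def)
  then have "x \<rightarrow>\<^sup>*\<^bsub>T\<^esub> y" using adj_sym[OF yx] by (intro T.reachable_adjI) (simp add: branch_tree_adj)
  then have "{v \<in> S. x \<rightarrow>\<^sup>*\<^bsub>T\<^esub> v} = S"
    using \<open>y \<in> S\<close> T.reachable_adj_trans
    by (intro linkedD[OF branch_linked[OF yx]]) (auto simp: branch_tree_adj)
  then show ?thesis using v by blast
qed

text \<open>If the branch behind \<open>u\<close> contained \<open>x\<close>, a shortest walk from
  \<open>x\<close> to \<open>v\<close> would leave it through \<open>u\<close>, making
  \<open>u\<close> closer than \<open>v\<close>. As this branch misses \<open>x\<close>, it cannot
  leave \<open>S\<close>.\<close>

lemma farther_vertex_branch:
  assumes uv: "u \<rightarrow>\<^bsub>T\<^esub> v" "graph_dist T x v < graph_dist T x u"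
  shows "u \<in> S" "x \<notin> branch_verts G u v" "branch_verts G u v \<subseteq> S"
proof -
  have reach: "x \<rightarrow>\<^sup>*\<^bsub>T\<^esub> v"
    using uv(1) branch_tree_reachable by (auto simp: branch_tree_adj branch_tree_verts)
  then obtain p where p: "T.awalk x p v" "graph_dist T x v = length p"
    by (rule T.dist_realized)
  have "T.awalk x [] x" by (simp add: T.awalk_Nil_iff branch_tree_verts)
  from T.dist_walk_le[OF this] have "graph_dist T x x \<le> 0" by (simp add: zero_ereal_def)
  moreover have "graph_dist T x v \<ge> 0" using p(2) by simp
  ultimately have "u \<noteq> x" using uv(2) by auto
  then show u: "u \<in> S" using uv(1) by (auto simp: branch_tree_adj)
  have uvG: "u \<rightarrow>\<^bsub>G\<^esub> v" using uv(1) by (simp add: branch_tree_adj)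
  note cut = branch_cut_off[OF uvG uvG]
  show x: "x \<notin> branch_verts G u v"
  proof
    assume xB: "x \<in> branch_verts G u v"
    obtain q where q: "T.awalk x q u" "length q < length p"
    proof (rule T.cut_off_walk[where B = "branch_verts G u v" and y = u and z = v, OF _ p(1)])
      show "a = u \<and> b = v" if "a \<in> branch_verts G u v" "a \<rightarrow>\<^bsub>T\<^esub> b" "b \<notin> branch_verts G u v" for a b
        using that cut by (auto simp: cut_off_def branch_tree_adj)
      show "v \<notin> branch_verts G u v" using cut by (simp add: cut_off_def)
    qed (rule xB, rule that)
    have "graph_dist T x u \<le> length q" by (rule T.dist_walk_le[OF q(1)])
    also have "\<dots> < graph_dist T x v" using q(2) p(2) by simp
    finally have "graph_dist T x u < graph_dist T x v" .
    then show False using uv(2) by simp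
  qed
  show "branch_verts G u v \<subseteq> S"
    using cut u x by (intro linked_subset_cut_off[OF branch_linked[OF uvG] branch_cut]) (auto simp: cut_off_def)
qed

text \<open>The drop of \<open>phi\<close> along an edge towards \<open>x\<close> is
  \<open>sig\<close> times the sum of its boundary values behind that edge, hence positive.
  Conversely, an admissible flow is positive on \<open>S\<close>, and positivity determines the
  eigenvalue.\<close>

lemma Sigma_flow_branch_tree:
  assumes sig: "sig > 0" and phi: "eigen_on G S sig phi"
    "\<And>v. v \<in> S \<Longrightarrow> phi v > 0" "\<And>v. v \<notin> S \<Longrightarrow> phi v = 0"
  shows "Sigma_flow T x = {sig}"
proof (intro equalityI subsetI)
  have xS: "x \<notin> S" "y \<in> S" using branch_cut by (auto simp: cut_off_def)
  fix lam assume "lam \<in> {sig}"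
  moreover have "phi v < phi u"
    if uv: "u \<rightarrow>\<^bsub>T\<^esub> v" "graph_dist T x v < graph_dist T x u" for u v
  proof -
    let ?B = "branch_verts G u v"
    have uvG: "u \<rightarrow>\<^bsub>G\<^esub> v" using uv(1) by (simp add: branch_tree_adj)
    note B = farther_vertex_branch[OF uv]
    obtain b where b: "b \<in> ?B" "b \<in> boundary_verts G" using branch_meets_boundary[OF uvG] by blast
    have "phi u - phi v = (\<Sum>w\<in>?B. laplacian G phi w)"
      by (rule sum_laplacian_cut[symmetric]) (rule branch_cut_off[OF uvG uvG])
    also have "\<dots> = (\<Sum>w\<in>?B. if w \<in> boundary_verts G then sig * phi w else 0)"
      using B(3) by (intro sum.cong eigen_onD[OF phi(1)]) auto
    also have "\<dots> > 0"
    proof (rule sum_pos2[of _ b])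
      show "finite ?B" by (rule finite_subset[OF branch_verts_subset]) simp
      show "0 \<le> (if w \<in> boundary_verts G then sig * phi w else 0)" if "w \<in> ?B" for w
        using phi(2)[of w] B(3) that sig by (auto intro!: mult_nonneg_nonneg less_imp_le)
      show "0 < (if b \<in> boundary_verts G then sig * phi b else 0)"
        using b(2) sig phi(2)[OF subsetD[OF B(3) b(1)]] by simp
    qed (fact b)
    finally show ?thesis by simp
  qed
  moreover have "lambda_flow T x sig phi"
    unfolding branch_tree_flow using phi(1) phi(2)[OF xS(2)] xS(2) by (auto intro!: bexI[of _ y])
  ultimately show "lam \<in> Sigma_flow T x"
    using sig phi(3)[OF xS(1)] by (auto simp: Sigma_flow_def)
next
  have xS: "x \<notin> S" "S \<subseteq> verts G" using branch_cut by (auto simp: cut_off_def)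
  fix lam assume "lam \<in> Sigma_flow T x"
  then obtain f where f: "eigen_on G S lam f" "f x = 0"
    and incr: "\<And>u v. u \<rightarrow>\<^bsub>T\<^esub> v \<Longrightarrow> graph_dist T x v < graph_dist T x u \<Longrightarrow> f v < f u"
    by (auto simp: Sigma_flow_def branch_tree_flow)
  have smaller: "\<exists>v\<in>insert x S. f v < f u" if u: "u \<in> S" for u
  proof -
    obtain v where "u \<rightarrow>\<^bsub>T\<^esub> v" "graph_dist T x v < graph_dist T x u"
      using T.exists_closer_neighbour[OF branch_tree_reachable[OF u]] u xS(1) by blast
    then show ?thesis using incr by (auto simp: branch_tree_adj)
  qed
  have fin: "finite (insert x S)" using finite_subset[OF xS(2)] by simp
  have pos: "f u > 0" if u: "u \<in> S" for u
  proof -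
    \<comment> \<open>No vertex of \<open>S\<close> can be a minimum, because a neighbor closer to
      \<open>x\<close> has a smaller value. So the minimum is \<open>f x = 0\<close>, attained at
      \<open>x\<close> alone.\<close>
    have "Min (f ` insert x S) \<in> f ` insert x S" using fin by (intro Min_in) auto
    then obtain w where w: "w \<in> insert x S" "f w = Min (f ` insert x S)" by force
    have le: "f w \<le> f v" if "v \<in> insert x S" for v
      unfolding w(2) using fin that by (intro Min_le) auto
    have "w = x" using smaller[of w] le w(1) by force
    then show ?thesis using smaller[OF u] le f(2) by force
  qed
  have "lam = sig"
    by (rule positive_eigen_unique[OF xS(2) branch_meets_boundary[OF yx]
          eigen_on_restrict[OF branch_cut f] _ _ phi]) (auto simp: pos)
  then show "lam \<in> {sig}" by simp
qed

lemma branch_ground_state: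
  obtains phi where "sigma_flow T x > 0" "eigen_on G S (sigma_flow T x) phi"
    "\<And>v. v \<in> S \<Longrightarrow> phi v > 0" "\<And>v. v \<notin> S \<Longrightarrow> phi v = 0"
    "\<And>g. (\<And>v. v \<notin> S \<Longrightarrow> g v = 0) \<Longrightarrow> sigma_flow T x * bdry_form G g g \<le> energy G g g"
proof -
  note ground = dirichlet_ground_state[OF branch_linked[OF yx] branch_verts_subset
      branch_meets_boundary[OF yx] adj_in_verts(2)[OF yx] head_notin_branch_verts[OF yx]]
  show thesis
  proof (rule ground)
    fix sig phi
    assume *: "sig > 0" "eigen_on G S sig phi"
      "\<And>v. v \<in> S \<Longrightarrow> phi v > 0" "\<And>v. v \<notin> S \<Longrightarrow> phi v = 0"
      "\<And>g. (\<And>v. v \<notin> S \<Longrightarrow> g v = 0) \<Longrightarrow> sig * bdry_form G g g \<le> energy G g g"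
    have eq: "sigma_flow T x = sig"
      using Sigma_flow_branch_tree[OF *(1-4)] by (simp add: sigma_flow_def)
    show thesis
      by (rule that[of phi]; (unfold eq)?) (use * in auto)
  qed
qed

end

end

section \<open>Comparison with the first nonzero Steklov eigenvalue\<close>

context connected_graph
begin

lemma steklov_weak:
  assumes "steklov_eigenfunction G lam f"
  shows "energy G f g = lam * bdry_form G f g"
  using assms eigen_on_weak[of "verts G" lam f g] by (auto simp: steklov_eigenfunction_iff)

text \<open>The constant function 1 is the test function, and its energy against \<open>f\<close> is
  0.\<close>

lemma steklov_orthogonal_const:
  assumes "steklov_eigenfunction G lam f" "lam \<noteq> 0"
  shows "(\<Sum>w\<in>boundary_verts G. f w) = 0"
  using steklov_weak[OF assms(1), of "\<lambda>_. 1"] assms(2) by (simp add: energy_def bdry_form_def)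

lemma steklov_bdry_pos:
  assumes "boundary_verts G \<noteq> {}" "steklov_eigenfunction G lam f"
  shows "bdry_form G f f > 0"
proof (rule ccontr)
  assume "\<not> bdry_form G f f > 0"
  then have B: "bdry_form G f f = 0" using bdry_form_nonneg[of G f] by simp
  then have "energy G f f + bdry_form G f f \<le> 0" using steklov_weak[OF assms(2), of f] by simp
  then have "\<forall>v\<in>verts G. f v = 0" using energy_bdry_zero[OF assms(1)] by blast
  then show False using assms(2) by (auto simp: steklov_eigenfunction_iff)
qed

text \<open>\<open>E / B\<close> is minimized over functions of zero boundary mean. Each
  eigenfunction with nonzero eigenvalue has zero mean, so the minimum is the least nonzero
  eigenvalue. The function \<open>f0\<close> shows that the problem is nontrivial and bounds the
  minimum.\<close>

lemma lambda2_minimizer: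
  assumes bd: "boundary_verts G \<noteq> {}"
    and f0: "\<And>v. v \<notin> verts G \<Longrightarrow> f0 v = 0" "(\<Sum>w\<in>boundary_verts G. f0 w) = 0"
      "bdry_form G f0 f0 > 0"
  shows "steklov_eigenvalue G (lambda2 G)" "lambda2 G \<noteq> 0"
    "lambda2 G * bdry_form G f0 f0 \<le> energy G f0 f0"
proof -
  \<comment> \<open>The constant 1, set to 0 off the graph so that subtracting multiples of it stays
    within functions vanishing there.\<close>
  define k where "k v = (if v \<in> verts G then 1 else (0::real))" for v
  have Bk: "bdry_form G f k = (\<Sum>w\<in>boundary_verts G. f w)" for f
    unfolding bdry_form_def using boundary_subset by (intro sum.cong) (auto simp: k_def)
  have Ek: "energy G f k = 0" for f
    unfolding green[symmetric] using sum_laplacian[of f] by (simp add: k_def)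
  define W where "W = {f. (\<forall>v. v \<notin> verts G \<longrightarrow> f v = 0) \<and> bdry_form G f k = 0}"
  have "closed ((\<Inter>v\<in>- verts G. (\<lambda>f. f v) -` {0}) \<inter> ((\<lambda>f. bdry_form G f k) -` {0}))"
    unfolding bdry_form_def
    by (intro closed_Int closed_INT ballI closed_vimage closed_singleton continuous_on_sum
        continuous_on_mult continuous_on_product_coordinates continuous_on_const)
  moreover have "W = (\<Inter>v\<in>- verts G. (\<lambda>f. f v) -` {0}) \<inter> ((\<lambda>f. bdry_form G f k) -` {0})"
    by (auto simp: W_def)
  ultimately have clW: "closed W" by simp
  have lin: "(\<lambda>v. f v + t * g v) \<in> W" if "f \<in> W" "g \<in> W" for f g t
    using that bdry_form_lincomb[of G 1 f t g k] by (auto simp: W_def)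
  have f0W: "f0 \<in> W" using f0 by (simp add: W_def Bk)
  obtain f lam where f: "f \<in> W" "bdry_form G f f > 0" "energy G f f = lam * bdry_form G f f"
    and min: "\<And>g. g \<in> W \<Longrightarrow> lam * bdry_form G g g \<le> energy G g g"
  proof (rule rayleigh_minimizer[OF bd clW _ _ f0W f0(3)])
    show "(\<lambda>v. c * f v) \<in> W" if "f \<in> W" for c f
      using that bdry_form_lincomb[of G c f 0 f k] by (auto simp: W_def)
  qed (auto simp: W_def)
  have "energy G f g = lam * bdry_form G f g" if g: "\<And>v. v \<notin> verts G \<Longrightarrow> g v = 0" for g
  proof -
    \<comment> \<open>The boundary mean of \<open>g\<close>. Removing it from \<open>g\<close>
      changes neither form against \<open>f\<close>, since \<open>k\<close> pairs to 0 with
      \<open>f\<close> in both.\<close>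
    define c where "c = bdry_form G g k / bdry_form G k k"
    have kk: "bdry_form G k k > 0"
      unfolding Bk using bd boundary_subset by (auto simp: k_def card_gt_0_iff subset_iff intro!: sum_pos)
    let ?g = "\<lambda>v. 1 * g v + (- c) * k v"
    have "bdry_form G ?g k = 0"
      unfolding bdry_form_lincomb using kk by (simp add: c_def)
    then have "?g \<in> W" using g by (simp add: W_def k_def)
    have "energy G f ?g = lam * bdry_form G f ?g"
      by (rule rayleigh_euler_lagrange[of W]) (fact lin, fact f(1), rule eq_refl[OF f(3)], fact min, fact)
    moreover have "energy G f ?g = energy G f g"
      unfolding energy_commute[of G f ?g] energy_lincomb energy_commute[of G k f]
        energy_commute[of G g f] Ek by simp
    moreover have "bdry_form G f ?g = bdry_form G f g"
      unfolding bdry_form_commute[of G f ?g] bdry_form_lincomb bdry_form_commute[of G k f]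
        bdry_form_commute[of G g f] using f(1) by (simp add: W_def)
    ultimately show ?thesis by simp
  qed
  then have eig: "eigen_on G (verts G) lam f" by (rule eigen_on_iff_weak[OF subset_refl])
  have "\<exists>v\<in>verts G. f v \<noteq> 0"
  proof (rule ccontr)
    assume "\<not> ?thesis"
    then have "bdry_form G f f = 0" using boundary_subset by (auto simp: bdry_form_def intro!: sum.neutral)
    then show False using f(2) by simp
  qed
  then have ev: "steklov_eigenvalue G lam"
    using eig by (auto simp: steklov_eigenvalue_def steklov_eigenfunction_iff)
  have nz: "lam \<noteq> 0"
  proof
    assume "lam = 0"
    then have E: "energy G f f = 0" using f(3) by simp
    obtain b where b: "b \<in> boundary_verts G" using bd by auto
    have const: "f v = f b" if "v \<in> boundary_verts G" for v
      using energy_zero_const[OF E] that b boundary_subset by blast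
    have "(\<Sum>w\<in>boundary_verts G. f w) = card (boundary_verts G) * f b"
      using const by (simp add: sum.cong[OF refl const])
    moreover have "card (boundary_verts G) > 0" using bd by (simp add: card_gt_0_iff)
    ultimately have "f b = 0" using f(1) by (auto simp: W_def Bk)
    then have "bdry_form G f f = 0" using const by (auto simp: bdry_form_def intro!: sum.neutral)
    then show False using f(2) by simp
  qed
  have "lambda2 G = lam"
    unfolding lambda2_def
  proof (rule Least_equality)
    fix mu assume "steklov_eigenvalue G mu \<and> mu \<noteq> 0"
    then obtain h where h: "steklov_eigenfunction G mu h" and mu: "mu \<noteq> 0"
      by (auto simp: steklov_eigenvalue_def)
    \<comment> \<open>Values off the graph are arbitrary, while membership in \<open>W\<close>
      requires them to be 0.\<close>
    define h' where "h' v = (if v \<in> verts G then h v else 0)" for v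
    have eq: "h v = h' v" if "v \<in> verts G" for v using that by (simp add: h'_def)
    have "bdry_form G h' k = 0"
      using steklov_orthogonal_const[OF h mu] bdry_form_cong[of h h' k, OF eq] by (simp add: Bk)
    then have "h' \<in> W" by (simp add: W_def h'_def)
    then have "lam * bdry_form G h' h' \<le> energy G h' h'" by (rule min)
    moreover have "energy G h' h' = energy G h h"
      using energy_cong[of h h' h, OF eq] energy_cong[of h h' h', OF eq] energy_commute[of G h h'] by simp
    moreover have "bdry_form G h' h' = bdry_form G h h"
      using bdry_form_cong[of h h' h, OF eq] bdry_form_cong[of h h' h', OF eq] bdry_form_commute[of G h h'] by simp
    ultimately have "lam * bdry_form G h h \<le> mu * bdry_form G h h"
      using steklov_weak[OF h, of h] by simp
    then show "lam \<le> mu" using steklov_bdry_pos[OF bd h] by simp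
  qed (use ev nz in simp)
  then show "steklov_eigenvalue G (lambda2 G)" "lambda2 G \<noteq> 0"
    "lambda2 G * bdry_form G f0 f0 \<le> energy G f0 f0"
    using ev nz min[OF f0W] by auto
qed

end

section \<open>Joining the branches at \<open>x\<close>: \<open>a\<close> and \<open>b\<close> carry
  the two smallest values\<close>

context tree_graph
begin

context
  fixes x a b :: 'a
  assumes xa: "x \<rightarrow>\<^bsub>G\<^esub> a" and xb: "x \<rightarrow>\<^bsub>G\<^esub> b" and ab: "a \<noteq> b"
    and order_a: "sigma_flow (branch_tree G a x) x \<le> sigma_flow (branch_tree G b x) x"
    and order_b: "\<And>y. x \<rightarrow>\<^bsub>G\<^esub> y \<Longrightarrow> y \<noteq> a \<Longrightarrow>
      sigma_flow (branch_tree G b x) x \<le> sigma_flow (branch_tree G y x) x"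
begin

private abbreviation (input) "br y \<equiv> branch_verts G y x"
private abbreviation (input) "sg y \<equiv> sigma_flow (branch_tree G y x) x"

private lemma cut: "x \<rightarrow>\<^bsub>G\<^esub> y \<Longrightarrow> cut_off G (br y) y x"
  using adj_sym branch_cut_off by blast

private lemma lnk: "x \<rightarrow>\<^bsub>G\<^esub> y \<Longrightarrow> linked G (br y)"
  using adj_sym branch_linked by blast

private lemma xV: "x \<in> verts G"
  using adj_in_verts[OF xa] by simp

private lemma bd: "boundary_verts G \<noteq> {}"
  using branch_meets_boundary[OF adj_sym[OF xa]] by auto

lemma x_interior: "x \<notin> boundary_verts G"
proof
  assume "x \<in> boundary_verts G"
  then obtain z where z: "{v. x \<rightarrow>\<^bsub>G\<^esub> v} = {z}" by (auto simp: boundary_iff card_1_singleton_iff)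
  have "a \<in> {v. x \<rightarrow>\<^bsub>G\<^esub> v}" "b \<in> {v. x \<rightarrow>\<^bsub>G\<^esub> v}" using xa xb by auto
  then show False using ab unfolding z by simp
qed

text \<open>The set is closed under adjacency: a branch can be left only to \<open>x\<close>, and
  each neighbor of \<open>x\<close> is the root of a branch.\<close>

lemma branches_cover: "verts G = insert x (\<Union>y\<in>{y. x \<rightarrow>\<^bsub>G\<^esub> y}. br y)"
proof (rule vert_closed_eq_verts[symmetric])
  show "insert x (\<Union>y\<in>{y. x \<rightarrow>\<^bsub>G\<^esub> y}. br y) \<subseteq> verts G" using xV branch_verts_subset by auto
next
  fix u v assume u: "u \<in> insert x (\<Union>y\<in>{y. x \<rightarrow>\<^bsub>G\<^esub> y}. br y)" and uv: "u \<rightarrow>\<^bsub>G\<^esub> v"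
  show "v \<in> insert x (\<Union>y\<in>{y. x \<rightarrow>\<^bsub>G\<^esub> y}. br y)"
  proof (cases "u = x")
    case True
    have "v \<in> br v" using adj_in_verts(2)[OF uv] by (rule self_mem_branch_verts)
    then show ?thesis using uv True by auto
  next
    case False
    then obtain y where y: "x \<rightarrow>\<^bsub>G\<^esub> y" "u \<in> br y" using u by auto
    then have "v \<in> br y \<or> v = x" using cut[OF y(1)] uv by (auto simp: cut_off_def)
    then show ?thesis using y(1) by auto
  qed
qed simp

text \<open>If two branches met, \<open>br z\<close>, which misses \<open>x\<close>, would lie in
  \<open>br y\<close>. Then \<open>z\<close> would be a second vertex of \<open>br y\<close>
  adjacent to \<open>x\<close>.\<close>

lemma branches_disjoint:
  assumes "x \<rightarrow>\<^bsub>G\<^esub> y" "x \<rightarrow>\<^bsub>G\<^esub> z" "y \<noteq> z"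
  shows "br y \<inter> br z = {}"
proof (rule ccontr)
  assume *: "br y \<inter> br z \<noteq> {}"
  have "x \<notin> br z" using cut[OF assms(2)] by (simp add: cut_off_def)
  then have "br z \<subseteq> br y"
    using * by (intro linked_subset_cut_off[OF lnk[OF assms(2)] cut[OF assms(1)]]) auto
  then have "z \<in> br y" using cut[OF assms(2)] by (auto simp: cut_off_def)
  then show False using cut[OF assms(1)] adj_sym[OF assms(2)] assms(3) unfolding cut_off_def by blast
qed

lemma branch_state:
  assumes "x \<rightarrow>\<^bsub>G\<^esub> y"
  obtains phi where "sg y > 0" "eigen_on G (br y) (sg y) phi"
    "\<And>v. v \<in> br y \<Longrightarrow> phi v > 0" "\<And>v. v \<notin> br y \<Longrightarrow> phi v = 0"
    "\<And>g. (\<And>v. v \<notin> br y \<Longrightarrow> g v = 0) \<Longrightarrow> sg y * bdry_form G g g \<le> energy G g g"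
  using branch_ground_state[OF adj_sym[OF assms]] by metis

lemma steklov_on_branch:
  "steklov_eigenfunction G lam f \<Longrightarrow> eigen_on G (br y) lam f"
  using branch_verts_subset by (auto simp: steklov_eigenfunction_iff intro: eigen_on_subset)

lemma steklov_vanishes_at_root:
  assumes y: "x \<rightarrow>\<^bsub>G\<^esub> y" and f: "steklov_eigenfunction G (sg y) f"
  shows "f x = 0"
proof (rule branch_state[OF y])
  fix phi assume *: "eigen_on G (br y) (sg y) phi" "\<And>v. v \<in> br y \<Longrightarrow> phi v > 0"
    "\<And>v. v \<notin> br y \<Longrightarrow> phi v = 0"
  have "phi y > 0" using cut[OF y] by (intro *(2)) (simp add: cut_off_def)
  then show "f x = 0"
    using green_cut[OF cut[OF y] *(1,3) steklov_on_branch[OF f]] by simp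
qed

lemma steklov_lower_bound:
  assumes f: "steklov_eigenfunction G lam f" and lam: "lam \<noteq> 0"
  shows "sg a \<le> lam"
proof (rule ccontr)
  assume less: "\<not> sg a \<le> lam"
  \<comment> \<open>The sign is chosen so that \<open>h x\<close> is nonnegative.\<close>
  define c where "c = (if f x \<ge> 0 then 1 else - 1 :: real)"
  define h where "h v = c * f v" for v
  have "eigen_on G (verts G) lam h"
    using f eigen_on_lincomb[of G "verts G" lam f f c 0] by (simp add: h_def[abs_def] steklov_eigenfunction_iff)
  moreover have "\<exists>v\<in>verts G. h v \<noteq> 0" using f by (auto simp: steklov_eigenfunction_iff h_def c_def)
  ultimately have h: "steklov_eigenfunction G lam h" by (simp add: steklov_eigenfunction_iff)
  have hx: "h x \<ge> 0" by (simp add: h_def c_def)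
  have nonneg: "h v \<ge> 0" if "v \<in> verts G" for v
  proof (cases "v = x")
    case False
    then obtain y where y: "x \<rightarrow>\<^bsub>G\<^esub> y" "v \<in> br y" using \<open>v \<in> verts G\<close> branches_cover by auto
    have "sg a \<le> sg y" using order_a order_b[OF y(1)] by (cases "y = a") auto
    then have lt: "lam < sg y" using less by simp
    show ?thesis
    proof (rule branch_state[OF y(1)])
      fix phi
      assume min: "\<And>g. (\<And>v. v \<notin> br y \<Longrightarrow> g v = 0) \<Longrightarrow> sg y * bdry_form G g g \<le> energy G g g"
      show "h v \<ge> 0"
      proof (rule eigen_on_nonneg[OF bd branch_verts_subset steklov_on_branch[OF h] _ lt min y(2)])
        show "h z \<ge> 0" if "u \<in> br y" "u \<rightarrow>\<^bsub>G\<^esub> z" "z \<notin> br y" for u z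
          using cut[OF y(1)] that hx unfolding cut_off_def by blast
      qed
    qed
  qed (use hx in simp)
  have "\<forall>w\<in>boundary_verts G. h w = 0"
    using steklov_orthogonal_const[OF h lam] nonneg boundary_subset
    by (subst (asm) sum_nonneg_eq_0_iff) auto
  then have "bdry_form G h h = 0" by (simp add: bdry_form_def)
  then show False using steklov_bdry_pos[OF bd h] by simp
qed

text \<open>Such an \<open>f\<close> vanishes at \<open>x\<close>, hence on all branches with a
  larger value. Harmonicity at \<open>x\<close> then gives \<open>f a = 0\<close>, and simplicity of
  the ground state removes \<open>f\<close> from the first branch.\<close>

lemma first_branch_value_not_eigenvalue:
  assumes lt: "sg a < sg b" and f: "steklov_eigenfunction G (sg a) f"
  shows False
proof -
  have fx: "f x = 0" by (rule steklov_vanishes_at_root[OF xa f])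
  have other: "f v = 0" if y: "x \<rightarrow>\<^bsub>G\<^esub> y" "y \<noteq> a" and v: "v \<in> br y" for y v
  proof (rule branch_state[OF y(1)])
    fix phi
    assume min: "\<And>g. (\<And>v. v \<notin> br y \<Longrightarrow> g v = 0) \<Longrightarrow> sg y * bdry_form G g g \<le> energy G g g"
    have "sg a < sg y" using lt order_b[OF y] by simp
    then have "(\<lambda>v. if v \<in> br y then f v else 0) v = 0"
      by (intro eigen_on_below_zero[OF bd branch_verts_subset
          eigen_on_restrict[OF cut[OF y(1)] steklov_on_branch[OF f] fx] _ _ min v]) auto
    then show "f v = 0" using v by simp
  qed
  have nbr0: "f y = 0" if "x \<rightarrow>\<^bsub>G\<^esub> y" "y \<noteq> a" for y
    using other[OF that] cut[OF that(1)] by (simp add: cut_off_def)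
  have "laplacian G f x = 0"
    using f xV x_interior by (simp add: steklov_eigenfunction_iff eigen_on_def)
  moreover have "laplacian G f x = (\<Sum>y | x \<rightarrow>\<^bsub>G\<^esub> y. if y = a then - f a else 0)"
    unfolding laplacian_def by (rule sum.cong) (auto simp: fx nbr0)
  ultimately have fa: "f a = 0" using xa by (simp add: sum.delta)
  have first: "f v = 0" if v: "v \<in> br a" for v
  proof (rule branch_state[OF xa])
    fix phi
    assume *: "eigen_on G (br a) (sg a) phi" "\<And>v. v \<in> br a \<Longrightarrow> phi v > 0"
      "\<And>v. v \<notin> br a \<Longrightarrow> phi v = 0"
    have "a \<in> br a" using cut[OF xa] by (simp add: cut_off_def)
    then have "(\<lambda>v. if v \<in> br a then f v else 0) v = 0"
      by (rule positive_eigen_simple[OF lnk[OF xa] branch_verts_subset _ *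
          eigen_on_restrict[OF cut[OF xa] steklov_on_branch[OF f] fx] _ _ v]) (auto simp: fa)
    then show "f v = 0" using v by simp
  qed
  have "f v = 0" if "v \<in> verts G" for v
  proof (cases "v = x")
    case False
    then obtain y where y: "x \<rightarrow>\<^bsub>G\<^esub> y" "v \<in> br y" using \<open>v \<in> verts G\<close> branches_cover by auto
    then show ?thesis using other[OF y(1) _ y(2)] first by (cases "y = a") auto
  qed (use fx in simp)
  then show False using f by (auto simp: steklov_eigenfunction_iff)
qed

text \<open>Extended by zero, a branch state solves the Steklov equation except for its flux
  \<open>phi y\<close> into \<open>x\<close>.\<close>

lemma laplacian_branch_state:
  assumes y: "x \<rightarrow>\<^bsub>G\<^esub> y" and phi: "eigen_on G (br y) sig phi" "\<And>v. v \<notin> br y \<Longrightarrow> phi v = 0"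
    and w: "w \<in> verts G"
  shows "laplacian G phi w
    = (if w \<in> boundary_verts G then sig * phi w else 0) - (if w = x then phi y else 0)"
proof (cases "w \<in> br y")
  case True
  then have "w \<noteq> x" using cut[OF y] by (auto simp: cut_off_def)
  then show ?thesis using eigen_onD[OF phi(1) True] by simp
next
  case False
  then show ?thesis using laplacian_off_cut[OF cut[OF y] _ w False, of phi] phi(2) by auto
qed

text \<open>Balance the two ground states so that their fluxes into \<open>x\<close> cancel.\<close>

lemma equal_branch_values_eigenvalue:
  assumes eq: "sg a = sg b"
  shows "steklov_eigenvalue G (sg a)"
proof (rule branch_state[OF xa], rule branch_state[OF xb])
  fix p q
  assume p: "eigen_on G (br a) (sg a) p" "\<And>v. v \<in> br a \<Longrightarrow> p v > 0" "\<And>v. v \<notin> br a \<Longrightarrow> p v = 0"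
    and q: "eigen_on G (br b) (sg b) q" "\<And>v. v \<in> br b \<Longrightarrow> q v > 0" "\<And>v. v \<notin> br b \<Longrightarrow> q v = 0"
  have aS: "a \<in> br a" "b \<in> br b" using cut[OF xa] cut[OF xb] by (auto simp: cut_off_def)
  then have "a \<notin> br b" using branches_disjoint[OF xa xb ab] by auto
  let ?f = "\<lambda>v. q b * p v + (- p a) * q v"
  have "?f a \<noteq> 0"
    using p(2)[OF aS(1)] q(2)[OF aS(2)] q(3)[OF \<open>a \<notin> br b\<close>] by simp
  then have "\<exists>v\<in>verts G. ?f v \<noteq> 0" using adj_in_verts(2)[OF xa] by (rule bexI)
  moreover have "eigen_on G (verts G) (sg a) ?f"
    unfolding eigen_on_def
  proof
    fix w assume w: "w \<in> verts G"
    have "laplacian G p w = (if w \<in> boundary_verts G then sg a * p w else 0) - (if w = x then p a else 0)"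
      by (rule laplacian_branch_state[OF xa p(1) _ w]) (rule p(3))
    moreover have "laplacian G q w =
        (if w \<in> boundary_verts G then sg a * q w else 0) - (if w = x then q b else 0)"
      unfolding eq by (rule laplacian_branch_state[OF xb q(1) _ w]) (rule q(3))
    ultimately show "laplacian G ?f w = (if w \<in> boundary_verts G then sg a * ?f w else 0)"
      unfolding laplacian_lincomb using x_interior by (simp add: right_diff_distrib)
  qed
  ultimately have "steklov_eigenfunction G (sg a) ?f"
    unfolding steklov_eigenfunction_iff by (rule conjI)
  then show ?thesis unfolding steklov_eigenvalue_def by blast
qed

text \<open>Balance the two ground states so that their boundary means cancel.\<close>

lemma lambda2_less:
  assumes lt: "sg a < sg b"
  shows "lambda2 G < sg b" "steklov_eigenvalue G (lambda2 G)" "lambda2 G \<noteq> 0"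
proof -
  obtain p where p: "eigen_on G (br a) (sg a) p" "\<And>v. v \<in> br a \<Longrightarrow> p v > 0" "\<And>v. v \<notin> br a \<Longrightarrow> p v = 0"
    by (rule branch_state[OF xa]) (rule that)
  obtain q where q: "eigen_on G (br b) (sg b) q" "\<And>v. v \<in> br b \<Longrightarrow> q v > 0" "\<And>v. v \<notin> br b \<Longrightarrow> q v = 0"
    by (rule branch_state[OF xb]) (rule that)
  define s where "s h = (\<Sum>w\<in>boundary_verts G. h w)" for h :: "'a \<Rightarrow> real"
  obtain wa wb where wa: "wa \<in> boundary_verts G" "wa \<in> br a" and wb: "wb \<in> boundary_verts G" "wb \<in> br b"
    using branch_meets_boundary[OF adj_sym[OF xa]] branch_meets_boundary[OF adj_sym[OF xb]] by blast
  have pn: "p v \<ge> 0" "q v \<ge> 0" for v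
    using p(2,3)[of v] q(2,3)[of v] by (cases "v \<in> br a"; cases "v \<in> br b"; simp)+
  have pq: "p wa > 0" "q wb > 0" using p(2)[OF wa(2)] q(2)[OF wb(2)] by auto
  have sp: "s p > 0"
    unfolding s_def by (rule sum_pos2[of _ wa]) (use wa pq pn in auto)
  have sq: "s q > 0"
    unfolding s_def by (rule sum_pos2[of _ wb]) (use wb pq pn in auto)
  have Bp: "bdry_form G p p > 0"
    unfolding bdry_form_def by (rule sum_pos2[of _ wa]) (use wa pq in auto)
  have Bq: "bdry_form G q q > 0"
    unfolding bdry_form_def by (rule sum_pos2[of _ wb]) (use wb pq in auto)
  have Bpq: "bdry_form G p q = 0"
    unfolding bdry_form_def using p(3) q(3) branches_disjoint[OF xa xb ab]
    by (intro sum.neutral) (auto simp: disjoint_iff)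
  \<comment> \<open>Disjoint supports remove every term of Green's sum except possibly the one at
    \<open>x\<close>, where \<open>q\<close> vanishes.\<close>
  have Epq: "energy G p q = 0"
    unfolding green[symmetric]
  proof (rule sum.neutral, rule ballI)
    fix w assume w: "w \<in> verts G"
    have "q w * p w = 0" using p(3)[of w] q(3)[of w] branches_disjoint[OF xa xb ab] by auto
    moreover have "q x = 0" using q(3) cut[OF xb] by (simp add: cut_off_def)
    moreover have "laplacian G p w
        = (if w \<in> boundary_verts G then sg a * p w else 0) - (if w = x then p a else 0)"
      by (rule laplacian_branch_state[OF xa p(1) _ w]) (rule p(3))
    ultimately show "q w * laplacian G p w = 0" by auto
  qed
  let ?g = "\<lambda>v. s q * p v + (- s p) * q v"
  have B: "bdry_form G ?g ?g = (s q)\<^sup>2 * bdry_form G p p + (s p)\<^sup>2 * bdry_form G q q"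
    unfolding bdry_form_quadratic by (simp add: Bpq)
  have Bg: "bdry_form G ?g ?g > 0"
    unfolding B using sp sq Bp Bq by (intro add_pos_pos mult_pos_pos) auto
  have "energy G ?g ?g = (s q)\<^sup>2 * (sg a * bdry_form G p p) + (s p)\<^sup>2 * (sg b * bdry_form G q q)"
    unfolding energy_quadratic using Epq eigen_on_weak[OF p(1) branch_verts_subset p(3)]
      eigen_on_weak[OF q(1) branch_verts_subset q(3)] by simp
  \<comment> \<open>Strict, because \<open>p\<close> enters with positive weight and
    \<open>sg a < sg b\<close>.\<close>
  also have "\<dots> < sg b * bdry_form G ?g ?g"
    unfolding B using lt sp sq Bp Bq by (simp add: algebra_simps)
  finally have E: "energy G ?g ?g < sg b * bdry_form G ?g ?g" .
  have off: "?g v = 0" if "v \<notin> verts G" for v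
  proof -
    have "v \<notin> br a" "v \<notin> br b" using that branch_verts_subset by auto
    then show ?thesis using p(3) q(3) by simp
  qed
  have orth: "(\<Sum>w\<in>boundary_verts G. ?g w) = 0"
    by (simp add: s_def sum_subtractf sum_distrib_left[symmetric])
  note min = lambda2_minimizer[OF bd off orth Bg]
  show "steklov_eigenvalue G (lambda2 G)" "lambda2 G \<noteq> 0" using min by simp_all
  have "lambda2 G * bdry_form G ?g ?g < sg b * bdry_form G ?g ?g" using min(3) E by linarith
  then show "lambda2 G < sg b" using Bg by simp
qed

lemma lambda2_branch_comparison:
  "(sg a = sg b \<longrightarrow> lambda2 G = sg a \<and> (\<forall>f. steklov_eigenfunction G (lambda2 G) f \<longrightarrow> f x = 0)) \<and>
   (sg a < sg b \<longrightarrow> sg a < lambda2 G \<and> lambda2 G < sg b)"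
proof (intro conjI impI allI)
  assume eq: "sg a = sg b"
  \<comment> \<open>Positivity makes \<open>sg a\<close> a nonzero eigenvalue, as the definition of
    \<open>lambda2\<close> demands.\<close>
  have "sg a > 0" by (rule branch_state[OF xa])
  then show eq2: "lambda2 G = sg a"
    unfolding lambda2_def using equal_branch_values_eigenvalue[OF eq]
    by (intro Least_equality) (auto simp: steklov_eigenvalue_def intro: steklov_lower_bound)
  show "f x = 0" if "steklov_eigenfunction G (lambda2 G) f" for f
    using steklov_vanishes_at_root[OF xa] that eq2 by simp
next
  assume lt: "sg a < sg b"
  note l2 = lambda2_less[OF lt]
  show "lambda2 G < sg b" by (rule l2(1))
  obtain f where f: "steklov_eigenfunction G (lambda2 G) f"
    using l2(2) by (auto simp: steklov_eigenvalue_def)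
  then show "sg a < lambda2 G"
    using steklov_lower_bound[OF f l2(3)] first_branch_value_not_eigenvalue[OF lt, of f]
    by (cases "sg a = lambda2 G") auto
qed

end

end

theorem theorem4p1:
  fixes G :: "('a, 'b) pre_digraph" and x :: 'a and m :: nat and xs :: "nat \<Rightarrow> 'a"
  assumes "finite_tree G"
    and "x \<in> verts G"
    and "out_degree G x = m"
    and "m \<ge> 2"
    and "bij_betw xs {1..m} {y. x \<rightarrow>\<^bsub>G\<^esub> y}"
    and "\<And>i j. 1 \<le> i \<Longrightarrow> i \<le> j \<Longrightarrow> j \<le> m \<Longrightarrow>
           sigma_flow (branch_tree G (xs i) x) x \<le> sigma_flow (branch_tree G (xs j) x) x"
  shows "(sigma_flow (branch_tree G (xs 1) x) x = sigma_flow (branch_tree G (xs 2) x) x \<longrightarrow>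
            lambda2 G = sigma_flow (branch_tree G (xs 1) x) x \<and>
            (\<forall>f. steklov_eigenfunction G (lambda2 G) f \<longrightarrow> f x = 0)) \<and>
         (sigma_flow (branch_tree G (xs 1) x) x < sigma_flow (branch_tree G (xs 2) x) x \<longrightarrow>
            sigma_flow (branch_tree G (xs 1) x) x < lambda2 G \<and>
            lambda2 G < sigma_flow (branch_tree G (xs 2) x) x)"
proof -
  have "graph G" "connected G" and cyc: "\<And>p. pre_digraph.cycle G p \<Longrightarrow> length p < 3"
    using assms(1) by (auto simp: finite_tree_def not_le[symmetric])
  then interpret tree_graph G
    by (intro tree_graph.intro connected_graph.intro connected_graph_axioms.intro
        tree_graph_axioms.intro)
  have img: "xs ` {1..m} = {y. x \<rightarrow>\<^bsub>G\<^esub> y}" and inj: "inj_on xs {1..m}"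
    using assms(5) by (auto simp: bij_betw_def)
  show ?thesis
  proof (rule lambda2_branch_comparison)
    show "x \<rightarrow>\<^bsub>G\<^esub> xs 1" "x \<rightarrow>\<^bsub>G\<^esub> xs 2" using img assms(4) by auto
    show "xs 1 \<noteq> xs 2" using inj_onD[OF inj, of 1 2] assms(4) by auto
    show "sigma_flow (branch_tree G (xs 1) x) x \<le> sigma_flow (branch_tree G (xs 2) x) x"
      using assms(4) by (intro assms(6)) auto
    fix y assume y: "x \<rightarrow>\<^bsub>G\<^esub> y" "y \<noteq> xs 1"
    then obtain i where i: "i \<in> {1..m}" "y = xs i" using img by blast
    \<comment> \<open>The index is thus at least 2, and the ordering can be applied from
      \<open>xs 2\<close> on.\<close>
    then have "i \<noteq> 1" using y(2) by auto
    then show "sigma_flow (branch_tree G (xs 2) x) x \<le> sigma_flow (branch_tree G y x) x"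
      using i by (auto intro!: assms(6))
  qed
qed

end
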